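(* Let $T=T(\mathbf{A},\mathcal{D})$ be a self-affine tile of $\mathbb{R}^n$. If $T$ has a polyhedral corner, then there exists an affine transformation $\varphi$ of $\mathbb{R}^n$ such that $\varphi(T)$ is an $(\mathbb{R}^+)^n$-tile. Consequently, $T$ is a finite union of translations of $n$-dimensional unit cubes up to an affine transformation, i.e. there is an invertible affine transformation $\psi$ of $\mathbb{R}^n$ such that $\psi(T)$ is a finite union of translates of $[0,1]^n$.
   Context: Self-affine tile: let $\mathbf{A}$ be a real $n\times n$ matrix that is expanding (all eigenvalues have modulus larger than $1$) and such that $m=|\det\mathbf{A}|$ is an integer larger than $1$; let $\mathcal{D}=\{\mathbf{d}_0,\dots,\mathbf{d}_{m-1}\}\subset\mathbb{R}^n$ be a set of $m$ vectors. There is a unique non-empty compact set $T=T(\mathbf{A},\mathcal{D})$ with $T=\bigcup_{\mathbf{d}\in\mathcal{D}}\mathbf{A}^{-1}(T+\mathbf{d})$; it is called a self-affine tile if it has non-empty interior. A convex polyhedral cone in $\mathbb{R}^n$ is a set $C=\{\lambda_1\mathbf{a}_1+\cdots+\lambda_m\mathbf{a}_m:\ \lambda_i\ge 0\}$ where $\mathbf{a}_1,\dots,\mathbf{a}_m$ are non-zero vectors for which there is a non-zero $\beta\in\mathbb{R}^n$ with $\langle\mathbf{a}_j,\beta\rangle>0$ for all $j$. $T$ has a polyhedral corner if there exist $x_0\in T$, $r>0$ and a convex polyhedral cone $C$ such that $B(x_0,r)\cap T=x_0+(B(\mathbf{0},r)\cap C)$, where $B(x,r)$ denotes the ball with center $x$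 and radius $r$. $\mathbb{R}^+=\{x\in\mathbb{R}:x\ge 0\}$. A compact set $S\subset\mathbb{R}^n$ is an $(\mathbb{R}^+)^n$-tile if there is a discrete set $\mathcal{J}\subset\mathbb{R}^n$ such that $S+\mathcal{J}=(\mathbb{R}^+)^n$ and $(S+t_1)\cap(S+t_2)$ has Lebesgue measure zero for all $t_1\neq t_2$ in $\mathcal{J}$. *)

theory Defs
  imports "HOL-Analysis.Analysis"
begin

text \<open>
  Eigenvalues of a real matrix are taken over the complex numbers.
\<close>

definition eigenvalue_of :: "real^'n^'n \<Rightarrow> complex \<Rightarrow> bool" where
  "eigenvalue_of A c \<longleftrightarrow>
     (\<exists>v :: complex^'n. v \<noteq> 0 \<and> map_matrix complex_of_real A *v v = c *s v)"

definition expanding :: "real^'n^'n \<Rightarrow> bool" where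
  "expanding A \<longleftrightarrow> (\<forall>c. eigenvalue_of A c \<longrightarrow> cmod c > 1)"

text \<open>
  The set \<open>T(A, D)\<close> enters as a predicate on \<open>T\<close>: by Hutchinson's theorem the non-empty
  compact solution of the set equation is unique, so the predicate determines \<open>T\<close>.
\<close>

definition self_affine_set :: "real^'n^'n \<Rightarrow> (real^'n) set \<Rightarrow> (real^'n) set \<Rightarrow> bool" where
  "self_affine_set A D T \<longleftrightarrow>
     expanding A \<and> finite D \<and> card D > 1 \<and> \<bar>det A\<bar> = real (card D) \<and>
     compact T \<and> T \<noteq> {} \<and> T = (\<Union>d\<in>D. (\<lambda>x. matrix_inv A *v (x + d)) ` T)"

definition self_affine_tile :: "real^'n^'n \<Rightarrow> (real^'n) set \<Rightarrow> (real^'n) set \<Rightarrow> bool" where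
  "self_affine_tile A D T \<longleftrightarrow> self_affine_set A D T \<and> interior T \<noteq> {}"

definition convex_polyhedral_cone :: "(real^'n) set \<Rightarrow> bool" where
  "convex_polyhedral_cone C \<longleftrightarrow>
     (\<exists>(k::nat) (a :: nat \<Rightarrow> real^'n) \<beta>.
        k \<ge> 1 \<and> (\<forall>j\<in>{1..k}. a j \<noteq> 0) \<and> \<beta> \<noteq> 0 \<and> (\<forall>j\<in>{1..k}. a j \<bullet> \<beta> > 0) \<and>
        C = {(\<Sum>j=1..k. l j *\<^sub>R a j) | l :: nat \<Rightarrow> real. \<forall>j\<in>{1..k}. l j \<ge> 0})"

definition has_polyhedral_corner :: "(real^'n) set \<Rightarrow> bool" where
  "has_polyhedral_corner T \<longleftrightarrow>
     (\<exists>x0\<in>T. \<exists>r>0. \<exists>C. convex_polyhedral_cone C \<and>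
        ball x0 r \<inter> T = (\<lambda>x. x0 + x) ` (ball 0 r \<inter> C))"

definition nonneg_orthant :: "(real^'n) set" where
  "nonneg_orthant = {x. \<forall>i. x $ i \<ge> 0}"

definition orthant_tile :: "(real^'n) set \<Rightarrow> bool" where
  "orthant_tile S \<longleftrightarrow> compact S \<and>
     (\<exists>J. discrete J \<and> {s + t | s t. s \<in> S \<and> t \<in> J} = nonneg_orthant \<and>
        (\<forall>t1\<in>J. \<forall>t2\<in>J. t1 \<noteq> t2 \<longrightarrow>
           (\<lambda>s. s + t1) ` S \<inter> (\<lambda>s. s + t2) ` S \<in> null_sets lebesgue))"

text \<open>Affine transformations are invertible.\<close>

definition affine_transformation :: "(real^'n \<Rightarrow> real^'n) \<Rightarrow> bool" where
  "affine_transformation f \<longleftrightarrow> (\<exists>P b. invertible P \<and> f = (\<lambda>x. P *v x + b))"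

definition unit_cube :: "(real^'n) set" where
  "unit_cube = {x. \<forall>i. 0 \<le> x $ i \<and> x $ i \<le> 1}"

end

theory Submission
  imports Defs "HOL-Computational_Algebra.Fundamental_Theorem_Algebra"
begin

text \<open>
The idea is to blow up the corner. Let \<open>T\<close> look like the cone \<open>C\<close> at \<open>x0\<close>. The set \<open>A\<^sup>k T\<close> is a union of
translates of \<open>T\<close> that overlap in null sets, because \<open>|det A| = card D\<close> leaves no room for larger
overlaps (\<open>negligible_overlap_digit_sums\<close>). Since \<open>A\<close> is expanding, \<open>A\<^sup>k T\<close> coincides near \<open>A\<^sup>k x0\<close> with the cone
\<open>A\<^sup>k C\<close> on a ball whose radius tends to infinity. So \<open>T\<close> tiles large patches of pointed cones.

Such a patch has two consequences. A single tile contains the apex, hence \<open>T\<close> has a point \<open>y\<close> at which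
it looks like \<open>A\<^sup>k C\<close> and with \<open>T \<subseteq> y + A\<^sup>k C\<close> (\<open>apex_of_cone_patch\<close>). Moreover the frontier of \<open>T\<close> is made of
finitely many translated pieces of the frontier of the cone
(\<open>frontier_subset_cone_frontier_translates\<close>), so \<open>T\<close> is bounded by finitely many hyperplanes and has only
finitely many points that strictly minimize a linear functional (\<open>finite_strict_minimizers\<close>). The points
\<open>y\<close> are of this kind. By the pigeonhole principle two exponents \<open>k < l\<close> have the same point \<open>y\<close> and
therefore the same cone \<open>K\<close>, and \<open>A\<^bsup>l-k\<^esup> K = K\<close> (\<open>invariant_cone_at_apex\<close>). Blowing up at \<open>y\<close> along powers of
\<open>A\<^bsup>l-k\<^esup>\<close> gives a tiling of all of \<open>K\<close> by translates of \<open>T\<close> (\<open>cone_tiling_of_invariant_cone\<close>).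

It remains to see that \<open>K\<close> is a simplicial cone (\<open>independent_generators\<close>). On each extreme ray with
direction \<open>e\<close> let \<open>\<tau> e\<close> be the first nonzero translation vector. Near \<open>\<tau> e\<close> the cone is covered by
\<open>T - y\<close> and by its translate by \<open>\<tau> e\<close> only, so \<open>T - y\<close> must look like \<open>(K + \<real> e) - K\<close> there. For two extreme rays \<open>e\<close> and
\<open>e'\<close>, the tiles at \<open>\<tau> e\<close> and \<open>\<tau>' e'\<close> then look like \<open>(K + \<real> e') - K\<close> and \<open>(K + \<real> e) - K\<close> near
\<open>\<tau> e + \<tau>' e'\<close>. As tiles overlap in null sets, \<open>(K + \<real> e) \<inter> (K + \<real> e')\<close> equals \<open>K\<close> up to the boundary.
A linear relation between the extreme rays would violate this for a suitable pair.

A linear map now takes \<open>K\<close> to the orthant, which is the first claim. In these coordinates the frontier of \<open>T\<close>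
lies in finitely many hyperplanes \<open>x $ i = c\<close>, and a set with this property is a finite union of
cubes whose side is small compared to the gaps between these hyperplanes (\<open>finite_union_of_cubes\<close>).
\<close>

section \<open>Inverses of expanding matrices\<close>

lemma matrix_inv_inverse:
  assumes "invertible A"
  shows "A ** matrix_inv A = mat 1" "matrix_inv A ** A = mat 1"
  using someI_ex[OF assms[unfolded invertible_def]] by (simp_all add: matrix_inv_def)

lemma linear_funpow:
  fixes f :: "'a::real_vector \<Rightarrow> 'a"
  shows "linear f \<Longrightarrow> linear (f ^^ k)"
  by (induction k) (simp_all add: linear_id linear_compose del: id_apply)

lemma tendsto_zero_contracting_recurrence:
  fixes u v :: "nat \<Rightarrow> real"
  assumes q: "0 \<le> q" "q < 1" and v: "v \<longlonglongrightarrow> 0" and u0: "\<And>k. 0 \<le> u k"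
    and rec: "\<And>k. u (Suc k) \<le> q * u k + v k"
  shows "u \<longlonglongrightarrow> 0"
proof (rule LIMSEQ_I)
  fix e :: real assume e: "0 < e"
  define d where "d = e / 2"
  have d: "0 < d" using e by (simp add: d_def)
  have "\<forall>\<^sub>F k in sequentially. v k < d * (1 - q)"
    using v d q by (intro order_tendstoD) auto
  then obtain N where N: "\<And>k. k \<ge> N \<Longrightarrow> v k < d * (1 - q)"
    by (auto simp: eventually_sequentially)
  have step: "u (N + m) - d \<le> q ^ m * \<bar>u N - d\<bar>" for m
  proof (induction m)
    case (Suc m)
    have "u (N + Suc m) - d \<le> q * u (N + m) + v (N + m) - d" using rec[of "N+m"] by simp
    also have "\<dots> \<le> q * (u (N + m) - d)" using N[of "N+m"] by (simp add: algebra_simps)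
    also have "\<dots> \<le> q * (q ^ m * \<bar>u N - d\<bar>)" using Suc q by (intro mult_left_mono) auto
    finally show ?case by simp
  qed simp
  have "(\<lambda>m. q ^ m * \<bar>u N - d\<bar>) \<longlonglongrightarrow> 0"
    using q by (intro tendsto_mult_left_zero LIMSEQ_realpow_zero) auto
  then have "\<forall>\<^sub>F m in sequentially. q ^ m * \<bar>u N - d\<bar> < d"
    using d by (intro order_tendstoD) auto
  then obtain M where M: "\<And>m. m \<ge> M \<Longrightarrow> q ^ m * \<bar>u N - d\<bar> < d"
    by (auto simp: eventually_sequentially)
  show "\<exists>no. \<forall>n\<ge>no. norm (u n - 0) < e"
  proof (intro exI[of _ "N + M"] allI impI)
    fix n assume n: "n \<ge> N + M"
    then have "u (N + (n - N)) - d < d" using step[of "n - N"] M[of "n - N"] by linarith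
    then show "norm (u n - 0) < e" using n u0[of n] by (simp add: d_def)
  qed
qed

lemma norm_vector_smult_complex:
  fixes x :: "complex^'n"
  shows "norm (c *s x) = cmod c * norm x"
  by (simp add: norm_vec_def norm_mult L2_set_right_distrib)

definition poly_act :: "complex^'n^'n \<Rightarrow> complex poly \<Rightarrow> complex^'n \<Rightarrow> complex^'n" where
  "poly_act M p x = (\<Sum>i\<le>degree p. coeff p i *s ((*v) M ^^ i) x)"

lemma poly_act_eq_sum:
  assumes "degree p \<le> N"
  shows "poly_act M p x = (\<Sum>i\<le>N. coeff p i *s ((*v) M ^^ i) x)"
  unfolding poly_act_def
  by (rule sum.mono_neutral_left) (use assms in \<open>auto simp: not_le intro!: coeff_eq_0\<close>)

lemma funpow_mult_vec_diff:
  fixes M :: "complex^'n^'n"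
  shows "((*v) M ^^ i) (x - c *s y) = ((*v) M ^^ i) x - c *s ((*v) M ^^ i) y"
  by (induction i) (simp_all add: matrix_vector_mult_diff_distrib vector_scalar_commute)

lemma poly_act_linear_factor:
  "poly_act M ([:-c, 1:] * q) x = poly_act M q (M *v x) - c *s poly_act M q x"
proof -
  let ?n = "degree q"
  have co: "coeff ([:-c, 1:] * q) i = (case i of 0 \<Rightarrow> 0 | Suc j \<Rightarrow> coeff q j) - c * coeff q i" for i
    by (simp add: coeff_pCons split: nat.split)
  have dg: "degree ([:-c, 1:] * q) \<le> Suc ?n"
    using degree_mult_le[of "[:-c, 1:]" q] by simp
  have "poly_act M ([:-c, 1:] * q) x
     = (\<Sum>i\<le>Suc ?n. (case i of 0 \<Rightarrow> 0 | Suc j \<Rightarrow> coeff q j) *s ((*v) M ^^ i) x)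
       - (\<Sum>i\<le>Suc ?n. (c * coeff q i) *s ((*v) M ^^ i) x)"
    unfolding poly_act_eq_sum[OF dg] co by (simp only: vector_sub_rdistrib sum_subtractf)
  also have "(\<Sum>i\<le>Suc ?n. (case i of 0 \<Rightarrow> 0 | Suc j \<Rightarrow> coeff q j) *s ((*v) M ^^ i) x)
     = (\<Sum>i\<le>?n. coeff q i *s ((*v) M ^^ i) (M *v x))"
    by (subst sum.atMost_Suc_shift) (simp del: funpow.simps add: funpow_Suc_right)
  also have "(\<Sum>i\<le>Suc ?n. (c * coeff q i) *s ((*v) M ^^ i) x) = c *s poly_act M q x"
    unfolding poly_act_def by (simp add: coeff_eq_0 vec.scale_sum_right)
  finally show ?thesis by (simp add: poly_act_def)
qed

lemma poly_act_diff: "poly_act M q (x - c *s y) = poly_act M q x - c *s poly_act M q y"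
  by (simp add: poly_act_def funpow_mult_vec_diff vector_ssub_ldistrib sum_subtractf
      vec.scale_sum_right mult.commute)

lemma poly_act_mult_vec: "poly_act M q (M *v x) = M *v poly_act M q x"
proof -
  have "((*v) M ^^ i) (M *v x) = M *v ((*v) M ^^ i) x" for i
    by (metis funpow_swap1)
  then show ?thesis
    by (simp add: poly_act_def vec.linear_sum[OF matrix_vector_mul_linear_gen] vector_scalar_commute)
qed

text \<open>
The iterates \<open>x, M x, M\<^sup>2 x, \<dots>\<close> outnumber the real dimension of the space, so they satisfy a linear
relation (or two of them coincide), and its coefficients are those of the polynomial. This replaces
the Jordan form: only the polynomial that annihilates one vector is ever factored.
\<close>

lemma exists_annihilating_poly:
  fixes M :: "complex^'n^'n"
  shows "\<exists>p. p \<noteq> 0 \<and> poly_act M p x = 0"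
proof (cases "inj_on (\<lambda>i. ((*v) M ^^ i) x) {..DIM(complex^'n)}")
  case True
  let ?h = "\<lambda>i. ((*v) M ^^ i) x"
  let ?N = "DIM(complex^'n)"
  have "dependent (?h ` {..?N})"
    by (rule dependent_biggerset) (subst card_image[OF True], simp)
  then obtain u v where u: "(\<Sum>v\<in>?h ` {..?N}. u v *\<^sub>R v) = 0" "v \<in> ?h ` {..?N}" "u v \<noteq> 0"
    by (auto simp: dependent_finite)
  then obtain j where j: "j \<le> ?N" "u (?h j) \<noteq> 0" by auto
  define p where "p = (\<Sum>i\<le>?N. monom (complex_of_real (u (?h i))) i)"
  have co: "coeff p i = (if i \<le> ?N then complex_of_real (u (?h i)) else 0)" for i
    by (auto simp: p_def coeff_sum coeff_monom sum.delta)
  have "degree p \<le> ?N" by (rule degree_le) (simp add: co)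
  then have "poly_act M p x = (\<Sum>i\<le>?N. complex_of_real (u (?h i)) *s ?h i)"
    by (simp add: poly_act_eq_sum co)
  also have "\<dots> = (\<Sum>i\<le>?N. u (?h i) *\<^sub>R ?h i)"
    by (rule sum.cong[OF refl]) (simp add: vec_eq_iff scaleR_conv_of_real[where 'a=complex])
  also have "\<dots> = 0" using u(1) by (subst (asm) sum.reindex[OF True]) (simp add: o_def)
  finally have "poly_act M p x = 0" .
  moreover have "p \<noteq> 0" using j co[of j] by auto
  ultimately show ?thesis by blast
next
  case False
  then obtain i j where ij: "i < j" "((*v) M ^^ i) x = ((*v) M ^^ j) x"
    by (metis linorder_inj_onI' )
  define p where "p = monom (1::complex) j - monom 1 i"
  have co: "coeff p k = (if k = j then 1 else 0) - (if k = i then 1 else 0)" for k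
    by (auto simp: p_def coeff_monom)
  have "degree p \<le> j" using ij by (intro degree_le) (simp add: co)
  then have "poly_act M p x = (\<Sum>k\<le>j. (if k = j then ((*v) M ^^ k) x else 0) - (if k = i then ((*v) M ^^ k) x else 0))"
    unfolding poly_act_eq_sum[OF \<open>degree p \<le> j\<close>]
    by (intro sum.cong[OF refl]) (use ij in \<open>auto simp: co\<close>)
  also have "\<dots> = 0" using ij by (simp add: sum_subtractf sum.delta)
  finally have "poly_act M p x = 0" .
  moreover have "p \<noteq> 0" using ij co[of j] by auto
  ultimately show ?thesis by blast
qed

text \<open>
Induction on the degree of a polynomial \<open>p = (X - c) q\<close> that annihilates \<open>x\<close>, where \<open>c\<close> is a root.
If \<open>c\<close> is an eigenvalue, the induction hypothesis applies to \<open>w = M x - c x\<close>, and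
\<open>B x = (x - B w) / c\<close> makes the iterates of \<open>x\<close> a contracting recurrence with a perturbation that
tends to \<open>0\<close>. Otherwise \<open>M - c\<close> is injective, so \<open>q\<close> already annihilates \<open>x\<close>.
\<close>

lemma inverse_iterates_tendsto_zero_complex:
  fixes M B :: "complex^'n^'n"
  assumes inv: "B ** M = mat 1" "M ** B = mat 1"
    and ev: "\<And>c v. v \<noteq> 0 \<Longrightarrow> M *v v = c *s v \<Longrightarrow> cmod c > 1"
  shows "(\<lambda>k. ((*v) B ^^ k) x) \<longlonglongrightarrow> 0"
proof -
  have "p \<noteq> 0 \<Longrightarrow> poly_act M p x = 0 \<Longrightarrow> degree p = d \<Longrightarrow> (\<lambda>k. ((*v) B ^^ k) x) \<longlonglongrightarrow> 0" for p d
  proof (induction d arbitrary: p x)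
    case 0
    then obtain a where "p = [:a:]" using degree_eq_zeroE by blast
    with 0 have "x = 0" by (simp add: poly_act_def)
    moreover have "((*v) B ^^ k) 0 = 0" for k by (induction k) auto
    ultimately show ?case by simp
  next
    case (Suc d)
    have "\<not> constant (poly p)" using Suc.prems by (simp add: constant_degree)
    then obtain c where "poly p c = 0" using fundamental_theorem_of_algebra by blast
    then obtain q where q: "p = [:-c, 1:] * q" by (auto simp: poly_eq_0_iff_dvd dvd_def)
    with Suc.prems have q0: "q \<noteq> 0" by auto
    have "degree p = Suc (degree q)" unfolding q using q0 by (subst degree_mult_eq) auto
    then have dq: "degree q = d" using Suc.prems by simp
    show ?case
    proof (cases "\<exists>v. v \<noteq> 0 \<and> M *v v = c *s v")
      case True
      then have c1: "cmod c > 1" using ev by blast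
      define w where "w = M *v x - c *s x"
      have "poly_act M q w = 0" using Suc.prems(2)
        unfolding q poly_act_linear_factor by (simp add: w_def poly_act_diff)
      then have lim: "(\<lambda>k. ((*v) B ^^ k) w) \<longlonglongrightarrow> 0" using Suc.IH q0 dq by blast
      have "B *v w = x - c *s (B *v x)"
        by (simp add: w_def matrix_vector_mult_diff_distrib vector_scalar_commute
            matrix_vector_mul_assoc inv)
      then have Bx: "B *v x = (1/c) *s (x - B *v w)" using c1
        by (auto simp: vector_ssub_ldistrib)
      have Bk: "((*v) B ^^ k) (c *s (x - y)) = c *s (((*v) B ^^ k) x - ((*v) B ^^ k) y)" for k c x y
        by (induction k) (simp_all add: matrix_vector_mult_diff_distrib vector_scalar_commute)
      have rec: "((*v) B ^^ Suc k) x = (1/c) *s (((*v) B ^^ k) x - ((*v) B ^^ Suc k) w)" for k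
        using Bk[of k "1/c" x "B *v w"] Bx by (simp del: funpow.simps add: funpow_Suc_right)
      have "(\<lambda>k. norm (((*v) B ^^ k) x)) \<longlonglongrightarrow> 0"
      proof (rule tendsto_zero_contracting_recurrence)
        show "0 \<le> cmod (1/c)" "cmod (1/c) < 1" using c1 by (simp_all add: norm_divide divide_less_eq)
        have "(\<lambda>k. norm (((*v) B ^^ Suc k) w)) \<longlonglongrightarrow> 0"
          using LIMSEQ_Suc[OF tendsto_norm_zero[OF lim]] .
        then show "(\<lambda>k. cmod (1/c) * norm (((*v) B ^^ Suc k) w)) \<longlonglongrightarrow> 0"
          by (rule tendsto_mult_right_zero)
        show "norm (((*v) B ^^ Suc k) x) \<le> cmod (1/c) * norm (((*v) B ^^ k) x)
            + cmod (1/c) * norm (((*v) B ^^ Suc k) w)" for k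
          unfolding rec[of k] norm_vector_smult_complex distrib_left[symmetric]
          by (intro mult_left_mono norm_triangle_ineq4) auto
      qed auto
      then show ?thesis by (rule tendsto_norm_zero_cancel)
    next
      case False
      have "M *v poly_act M q x = c *s poly_act M q x"
        using Suc.prems(2) unfolding q poly_act_linear_factor by (simp add: poly_act_mult_vec)
      then have "poly_act M q x = 0" using False by blast
      then show ?thesis using Suc.IH q0 dq by blast
    qed
  qed
  then show ?thesis using exists_annihilating_poly by blast
qed

lemma uniform_decay_of_pointwise_decay:
  fixes g :: "'a::euclidean_space \<Rightarrow> 'a"
  assumes lin: "linear g" and lim: "\<And>x. (\<lambda>k. (g ^^ k) x) \<longlonglongrightarrow> 0" and e: "0 < e"
  shows "\<forall>\<^sub>F k in sequentially. \<forall>x. norm ((g ^^ k) x) \<le> e * norm x"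
proof -
  have lk: "linear (g ^^ k)" for k using lin by (rule linear_funpow)
  have "(\<lambda>k. \<Sum>b\<in>Basis. norm ((g ^^ k) b)) \<longlonglongrightarrow> (\<Sum>b\<in>(Basis::'a set). 0)"
    by (intro tendsto_sum tendsto_norm_zero lim)
  then have "\<forall>\<^sub>F k in sequentially. (\<Sum>b\<in>Basis. norm ((g ^^ k) b)) < e"
    using e by (intro order_tendstoD) auto
  then show ?thesis
  proof eventually_elim
    case (elim k)
    show ?case
    proof
      fix x :: 'a
      have "(g ^^ k) x = (g ^^ k) (\<Sum>b\<in>Basis. (x \<bullet> b) *\<^sub>R b)" by (simp add: euclidean_representation)
      also have "\<dots> = (\<Sum>b\<in>Basis. (x \<bullet> b) *\<^sub>R (g ^^ k) b)"
        by (simp add: linear_sum[OF lk] linear_scale[OF lk])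
      finally have "norm ((g ^^ k) x) \<le> (\<Sum>b\<in>Basis. \<bar>x \<bullet> b\<bar> * norm ((g ^^ k) b))"
        by (metis (no_types, lifting) norm_scaleR norm_sum sum.cong)
      also have "\<dots> \<le> (\<Sum>b\<in>Basis. norm x * norm ((g ^^ k) b))"
        by (intro sum_mono mult_right_mono Basis_le_norm) auto
      also have "\<dots> = norm x * (\<Sum>b\<in>Basis. norm ((g ^^ k) b))" by (simp add: sum_distrib_left)
      also have "\<dots> \<le> norm x * e" using elim by (intro mult_left_mono) auto
      also have "\<dots> = e * norm x" by simp
      finally show "norm ((g ^^ k) x) \<le> e * norm x" .
    qed
  qed
qed

lemma expanding_inverse_contracts:
  fixes A :: "real^'n^'n"
  assumes ex: "expanding A" and inv: "invertible A" and e: "0 < e"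
  shows "\<forall>\<^sub>F k in sequentially. \<forall>x. norm (((*v) (matrix_inv A) ^^ k) x) \<le> e * norm x"
proof (rule uniform_decay_of_pointwise_decay[OF _ _ e])
  let ?C = "map_matrix complex_of_real :: real^'n^'n \<Rightarrow> complex^'n^'n"
  let ?c = "\<lambda>x::real^'n. (\<chi> i. complex_of_real (x $ i)) :: complex^'n"
  let ?B = "matrix_inv A"
  show "linear ((*v) ?B)" by simp
  have mult: "?C X ** ?C Y = ?C (X ** Y)" for X Y
    by (simp add: vec_eq_iff matrix_matrix_mult_def map_matrix_def)
  have one: "?C (mat 1) = mat 1" by (simp add: vec_eq_iff mat_def map_matrix_def)
  have vecc: "?C X *v ?c x = ?c (X *v x)" for X x
    by (simp add: vec_eq_iff matrix_vector_mult_def map_matrix_def)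
  fix x :: "real^'n"
  have AB: "A ** ?B = mat 1" "?B ** A = mat 1" using matrix_inv_inverse[OF inv] by auto
  have "(\<lambda>k. ((*v) (?C ?B) ^^ k) (?c x)) \<longlonglongrightarrow> 0"
    by (rule inverse_iterates_tendsto_zero_complex[of _ "?C A"])
      (use ex in \<open>auto simp: mult AB one expanding_def eigenvalue_of_def\<close>)
  moreover have "((*v) (?C ?B) ^^ k) (?c x) = ?c (((*v) ?B ^^ k) x)" for k
    by (induction k) (simp_all add: vecc)
  ultimately have "(\<lambda>k. ?c (((*v) ?B ^^ k) x)) \<longlonglongrightarrow> 0" by simp
  from tendsto_norm_zero[OF this] have "(\<lambda>k. norm (?c (((*v) ?B ^^ k) x))) \<longlonglongrightarrow> 0" .
  moreover have "norm (?c y) = norm y" for y by (simp add: norm_vec_def)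
  ultimately show "(\<lambda>k. ((*v) ?B ^^ k) x) \<longlonglongrightarrow> 0"
    using tendsto_norm_zero_cancel by (metis (no_types, lifting) ext)
qed

section \<open>Measure of linear images\<close>

text \<open>
Both sides are multiplicative in \<open>f\<close>, so elementary maps suffice. A shear has determinant \<open>1\<close>, being
a row operation on the identity, and it preserves the volume of boxes; a coordinate swap is a
product of shears and stretches.
\<close>

lemma lmeasurable_linear_image:
  fixes f :: "real^'n \<Rightarrow> real^'n"
  assumes "linear f" and S: "S \<in> lmeasurable"
  shows "f ` S \<in> lmeasurable \<and> measure lebesgue (f ` S) = \<bar>det (matrix f)\<bar> * measure lebesgue S"
proof -
  define P where "P f \<longleftrightarrow> (\<forall>S \<in> lmeasurable. f ` S \<in> lmeasurable \<and>
     measure lebesgue (f ` S) = \<bar>det (matrix f)\<bar> * measure lebesgue S)" for f :: "real^'n \<Rightarrow> real^'n"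
  have comp: "P (f \<circ> g)" if "linear f" "linear g" "P f" "P g" for f g
    using that unfolding P_def image_comp[symmetric] by (simp add: matrix_compose det_mul abs_mult)
  have stretch: "P (\<lambda>x. \<chi> i. c i * x $ i)" for c
    by (auto simp: P_def measurable_stretch measure_stretch matrix_def axis_def det_diagonal)
  have linst: "linear (\<lambda>x::real^'n. \<chi> i. c i * x $ i)" for c
    by (rule linearI) (auto simp: vec_eq_iff algebra_simps)
  have linsh: "linear (\<lambda>x::real^'n. \<chi> i. if i = m then x$m + x$n else x$i)" for m n
    by (rule linearI) (auto simp: vec_eq_iff algebra_simps)
  have shear: "P (\<lambda>x. \<chi> i. if i = m then x$m + x$n else x$i)" if mn: "m \<noteq> n" for m n
  proof -
    let ?h = "\<lambda>x::real^'n. \<chi> i. if i = m then x$m + x$n else x$i"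
    have "matrix ?h = (\<chi> k. if k = m then row m (mat 1) + 1 *s row n (mat 1) else row k (mat 1))"
      by (auto simp: matrix_def row_def mat_def axis_def vec_eq_iff)
    then have det: "det (matrix ?h) = 1" using det_row_operation[OF mn, of "mat 1" "1::real"] by simp
    have box: "measure lebesgue (?h ` cbox a b) = 1 * measure lebesgue (cbox a b)" for a b
    proof (cases "cbox a b = {}")
      case False
      \<comment> \<open>The volume of a sheared box is known when the \<open>n\<close>-th lower bound is nonnegative; translating
        the box achieves this without affecting either volume.\<close>
      define v :: "real^'n" where "v = - (a $ n) *\<^sub>R axis n 1"
      have "?h ` ((+) v ` cbox a b) = (+) (?h v) ` (?h ` cbox a b)"
        by (simp add: image_image linear_add[OF linsh])
      then have "measure lebesgue (?h ` cbox a b) = measure lebesgue (?h ` ((+) v ` cbox a b))"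
        by (simp add: measure_translation)
      also have "\<dots> = measure lebesgue ((+) v ` cbox a b)"
        unfolding cbox_translation[symmetric]
      proof (rule measure_shear_interval[OF mn])
        show "cbox (v + a) (v + b) \<noteq> {}" using False by (simp add: cbox_translation)
        show "0 \<le> (v + a) $ n" by (simp add: v_def)
      qed
      also have "\<dots> = measure lebesgue (cbox a b)" by (rule measure_translation)
      finally show ?thesis by simp
    qed simp
    show ?thesis unfolding P_def det
    proof
      fix S :: "(real^'n) set" assume "S \<in> lmeasurable"
      from measure_linear_sufficient[OF linsh this box]
      show "?h ` S \<in> lmeasurable \<and> measure lebesgue (?h ` S) = \<bar>1\<bar> * measure lebesgue S"
        by (metis abs_one)
    qed
  qed
  have "P f"
  proof (rule induct_linear_elementary[OF \<open>linear f\<close>])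
    show "P (f \<circ> g)" if "linear f" "linear g" "P f" "P g" for f g using comp that by blast
    show "P f" if lf: "linear f" and 0: "\<And>x. f x $ i = 0" for f i
    proof -
      have "axis i 1 \<notin> range f" using 0 by (metis axis_index rangeE zero_neq_one axis_nth)
      then have ni: "\<not> inj f" using linear_injective_imp_surjective[OF lf] by blast
      then have "det (matrix f) = 0" using det_nz_iff_inj[OF lf] by blast
      moreover have "negligible (f ` S)" for S
        using negligible_linear_singular_image[OF lf ni] .
      ultimately show ?thesis
        by (simp add: P_def negligible_imp_measurable negligible_imp_measure0)
    qed
    show "P (\<lambda>x. \<chi> i. c i * x $ i)" for c by (rule stretch)
    show "P (\<lambda>x. \<chi> i. if i = m then x$m + x$n else x$i)" if "m \<noteq> n" for m n by (rule shear[OF that])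
    show "P (\<lambda>x. \<chi> i. x $ Transposition.transpose m n i)" if mn: "m \<noteq> n" for m n
    proof -
      \<comment> \<open>A swap of two coordinates is \<open>(a, b) \<mapsto> (a + b, -b) \<mapsto> (-(a + b), a) \<mapsto> (b, a)\<close>.\<close>
      define h k where "h = (\<lambda>m n. \<lambda>x::real^'n. \<chi> i. if i = m then x$m + x$n else x$i)"
        and "k = (\<lambda>m. \<lambda>x::real^'n. \<chi> i. (if i = m then -1 else 1) * x$i)"
      have h: "P (h m n)" "P (h n m)" "linear (h m n)" "linear (h n m)"
        using shear mn linsh by (auto simp: h_def)
      have k: "P (k m)" "P (k n)" "linear (k m)" "linear (k n)"
        unfolding k_def by (rule stretch linst)+
      have "(\<lambda>x. \<chi> i. x $ Transposition.transpose m n i)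
          = k m \<circ> (h m n \<circ> (k m \<circ> (h n m \<circ> (k n \<circ> h m n))))"
        using mn by (auto simp: fun_eq_iff vec_eq_iff h_def k_def Transposition.transpose_def)
      moreover have "P \<dots>" by (intro comp linear_compose h k)
      ultimately show ?thesis by simp
    qed
  qed
  then show ?thesis using S by (simp add: P_def)
qed

section \<open>Powers of the matrix applied to a self-affine tile\<close>

lemma image_eq_of_self_affine:
  assumes "self_affine_set A D T"
  shows "invertible A" "(*v) A ` T = (\<Union>d\<in>D. (+) d ` T)"
proof -
  have sa: "\<bar>det A\<bar> = real (card D)" "card D > 1"
    and T: "T = (\<Union>d\<in>D. (\<lambda>x. matrix_inv A *v (x + d)) ` T)"
    using assms by (simp_all add: self_affine_set_def)
  show inv: "invertible A" using sa by (auto simp: invertible_det_nz)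
  have *: "A *v (matrix_inv A *v x) = x" for x
    using matrix_inv_inverse[OF inv] by (simp add: matrix_vector_mul_assoc)
  have "(*v) A ` T = (*v) A ` (\<Union>d\<in>D. (\<lambda>x. matrix_inv A *v (x + d)) ` T)" using T by simp
  also have "\<dots> = (\<Union>d\<in>D. (+) d ` T)"
    by (simp add: image_UN image_image * add.commute)
  finally show "(*v) A ` T = (\<Union>d\<in>D. (+) d ` T)" .
qed

text \<open>
The set \<open>D + A D + \<dots> + A\<^bsup>k-1\<^esup> D\<close>: the translation vectors in the decomposition of \<open>A\<^sup>k T\<close> into
copies of \<open>T\<close>.
\<close>

primrec digit_sums :: "real^'n^'n \<Rightarrow> (real^'n) set \<Rightarrow> nat \<Rightarrow> (real^'n) set" where
  "digit_sums A D 0 = {0}"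
| "digit_sums A D (Suc k) = (\<lambda>(d, e). d + A *v e) ` (D \<times> digit_sums A D k)"

lemma finite_digit_sums: "finite D \<Longrightarrow> finite (digit_sums A D k)"
  by (induction k) auto

lemma card_digit_sums_le: "finite D \<Longrightarrow> card (digit_sums A D k) \<le> card D ^ k"
proof (induction k)
  case (Suc k)
  have "card (digit_sums A D (Suc k)) \<le> card (D \<times> digit_sums A D k)"
    unfolding digit_sums.simps by (rule card_image_le) (simp add: Suc finite_digit_sums)
  also have "\<dots> \<le> card D ^ Suc k" using Suc by (simp add: card_cartesian_product)
  finally show ?case .
qed simp

text \<open>
Splitting an expansion of length \<open>a + b\<close> into its first \<open>a\<close> and its last \<open>b\<close> digits. This is what
makes the tilings of larger and larger parts of a cone extend one another.
\<close>

lemma digit_sums_add: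
  fixes A :: "real^'n^'n"
  assumes "d \<in> digit_sums A D a" "e \<in> digit_sums A D b"
  shows "d + ((*v) A ^^ a) e \<in> digit_sums A D (a + b)"
  using assms(1)
proof (induction a arbitrary: d)
  case 0
  then show ?case using assms(2) by simp
next
  case (Suc a)
  then obtain d0 d' where d: "d = d0 + A *v d'" "d0 \<in> D" "d' \<in> digit_sums A D a" by auto
  have "d' + ((*v) A ^^ a) e \<in> digit_sums A D (a + b)" using Suc.IH d by blast
  moreover have "d + ((*v) A ^^ Suc a) e = d0 + A *v (d' + ((*v) A ^^ a) e)"
    by (simp add: d matrix_vector_right_distrib)
  ultimately show ?case using d(2) by force
qed

lemma funpow_image_self_affine:
  assumes "self_affine_set A D T"
  shows "((*v) A ^^ k) ` T = (\<Union>d\<in>digit_sums A D k. (+) d ` T)"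
proof (induction k)
  case (Suc k)
  have "((*v) A ^^ Suc k) ` T = (*v) A ` (((*v) A ^^ k) ` T)" by (simp add: image_comp)
  also have "\<dots> = (\<Union>e\<in>digit_sums A D k. (+) (A *v e) ` ((*v) A ` T))"
    by (simp add: Suc image_UN image_image matrix_vector_right_distrib)
  also have "\<dots> = (\<Union>e\<in>digit_sums A D k. \<Union>d\<in>D. (+) (d + A *v e) ` T)"
    by (simp add: image_eq_of_self_affine(2)[OF assms] image_UN image_image ac_simps)
  also have "\<dots> = (\<Union>d\<in>digit_sums A D (Suc k). (+) d ` T)" by auto
  finally show ?case .
qed simp

lemma negligible_overlap_if_measure_Union:
  assumes fin: "finite I" and S: "\<And>i. i \<in> I \<Longrightarrow> S i \<in> lmeasurable"
    and le: "(\<Sum>i\<in>I. measure lebesgue (S i)) \<le> measure lebesgue (\<Union>i\<in>I. S i)"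
    and ij: "i \<in> I" "j \<in> I" "i \<noteq> j"
  shows "negligible (S i \<inter> S j)"
proof -
  let ?m = "measure lebesgue" and ?R = "\<Union>k\<in>I - {i,j}. S k"
  have R: "?R \<in> lmeasurable" using fin S by (intro fmeasurable.finite_UN) auto
  have eq: "(\<Union>k\<in>I. S k) = (S i \<union> S j) \<union> ?R" using ij by auto
  have "?m (\<Union>k\<in>I. S k) \<le> ?m (S i \<union> S j) + ?m ?R"
    unfolding eq using R S ij by (intro measure_Un_le) (auto intro: fmeasurableD)
  also have "?m (S i \<union> S j) = ?m (S i) + ?m (S j) - ?m (S i \<inter> S j)"
    using S ij by (intro measure_Un3) auto
  also have "?m ?R \<le> (\<Sum>k\<in>I - {i,j}. ?m (S k))"
    using fin S by (intro measure_UNION_le) (auto intro: fmeasurableD)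
  finally have "?m (\<Union>k\<in>I. S k) \<le> ?m (S i) + ?m (S j) - ?m (S i \<inter> S j) + (\<Sum>k\<in>I - {i,j}. ?m (S k))"
    by simp
  moreover have "(\<Sum>k\<in>I. ?m (S k)) = ?m (S i) + (?m (S j) + (\<Sum>k\<in>I - {i,j}. ?m (S k)))"
    using fin ij by (subst sum.remove[of _ i], simp, simp, subst sum.remove[of _ j])
      (auto simp: insert_commute Diff_insert2[symmetric] intro!: sum.cong)
  ultimately have "?m (S i \<inter> S j) \<le> 0" using le by simp
  then show ?thesis using S ij
    by (simp add: negligible_iff_measure fmeasurable.Int measure_le_0_iff)
qed

lemma measure_funpow_image:
  fixes A :: "real^'n^'n"
  assumes "S \<in> lmeasurable"
  shows "((*v) A ^^ k) ` S \<in> lmeasurable \<and>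
    measure lebesgue (((*v) A ^^ k) ` S) = \<bar>det A\<bar> ^ k * measure lebesgue S"
proof (induction k)
  case (Suc k)
  have eq: "((*v) A ^^ Suc k) ` S = (*v) A ` (((*v) A ^^ k) ` S)" by (simp add: image_comp)
  show ?case unfolding eq using Suc
    using lmeasurable_linear_image[of "(*v) A" "((*v) A ^^ k) ` S"]
    by (simp add: matrix_of_matrix_vector_mul)
qed (simp add: assms)

text \<open>
The set \<open>A\<^sup>k T\<close> has measure \<open>|det A|\<^sup>k \<mu>(T) = card D\<^sup>k \<mu>(T)\<close>, and it is a union of at most \<open>card D\<^sup>k\<close>
copies of \<open>T\<close>. No measure may be lost, so distinct copies overlap in null sets.
\<close>

lemma negligible_overlap_digit_sums:
  assumes sa: "self_affine_set A D T"
    and d: "d \<in> digit_sums A D k" "e \<in> digit_sums A D k" "d \<noteq> e"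
  shows "negligible ((+) d ` T \<inter> (+) e ` T)"
proof (rule negligible_overlap_if_measure_Union[OF _ _ _ d])
  have fin: "finite D" and cT: "compact T" and det: "\<bar>det A\<bar> = real (card D)"
    using sa by (auto simp: self_affine_set_def)
  show "finite (digit_sums A D k)" by (rule finite_digit_sums[OF fin])
  have T: "T \<in> lmeasurable" using cT by (rule lmeasurable_compact)
  show "(+) c ` T \<in> lmeasurable" for c using T by (simp add: measurable_translation)
  have "(\<Sum>c\<in>digit_sums A D k. measure lebesgue ((+) c ` T))
      = real (card (digit_sums A D k)) * measure lebesgue T"
    by (simp add: measure_translation)
  also have "\<dots> \<le> real (card D ^ k) * measure lebesgue T"
    by (intro mult_right_mono of_nat_mono card_digit_sums_le fin) auto
  also have "\<dots> = measure lebesgue (((*v) A ^^ k) ` T)"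
    using measure_funpow_image[OF T, where A=A and k=k] det by simp
  finally show "(\<Sum>c\<in>digit_sums A D k. measure lebesgue ((+) c ` T))
      \<le> measure lebesgue (\<Union>c\<in>digit_sums A D k. (+) c ` T)"
    by (simp add: funpow_image_self_affine[OF sa])
qed

lemma funpow_inverse:
  fixes f g :: "'a \<Rightarrow> 'a"
  assumes "\<And>x. g (f x) = x"
  shows "(g ^^ k) ((f ^^ k) x) = x"
proof (induction k arbitrary: x)
  case (Suc k)
  then show ?case using assms by (simp del: funpow.simps add: funpow_Suc_right[of _ g] funpow.simps(2)[of _ f])
qed simp

lemma funpow_matrix_inv:
  fixes A :: "real^'n^'n"
  assumes "invertible A"
  shows "((*v) (matrix_inv A) ^^ k) (((*v) A ^^ k) x) = x"
    and "((*v) A ^^ k) (((*v) (matrix_inv A) ^^ k) x) = x"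
  using matrix_inv_inverse[OF assms]
  by (auto intro!: funpow_inverse simp: matrix_vector_mul_assoc)

text \<open>
Each point of \<open>T\<close> lies in some piece \<open>A\<^bsup>-k\<^esup>(T + d)\<close>, which is as small as desired and contains
interior points of \<open>T\<close>, since \<open>A\<^bsup>-k\<^esup>\<close> is a homeomorphism.
\<close>

lemma self_affine_tile_regular_closed:
  fixes A :: "real^'n^'n"
  assumes tile: "self_affine_tile A D T"
  shows "closure (interior T) = T"
proof
  have sa: "self_affine_set A D T" and cT: "compact T" and ex: "expanding A"
    using tile by (auto simp: self_affine_tile_def self_affine_set_def)
  note inv = image_eq_of_self_affine(1)[OF sa]
  let ?f = "\<lambda>k. (*v) A ^^ k" and ?g = "\<lambda>k. (*v) (matrix_inv A) ^^ k"
  have lf: "linear (?f k)" and lg: "linear (?g k)" for k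
    by (intro linear_funpow; simp)+
  show "closure (interior T) \<subseteq> T"
    using cT by (metis closure_closed closure_mono compact_imp_closed interior_subset)
  obtain c where c: "c \<in> interior T" using tile by (auto simp: self_affine_tile_def)
  obtain M where M: "0 < M" "\<And>x. x \<in> T \<Longrightarrow> norm x \<le> M"
    using compact_imp_bounded[OF cT] by (auto simp: bounded_pos)
  show "T \<subseteq> closure (interior T)"
  proof
    fix x assume x: "x \<in> T"
    show "x \<in> closure (interior T)"
      unfolding closure_approachable
    proof (intro allI impI)
      fix e :: real assume e: "0 < e"
      \<comment> \<open>Two points of \<open>T\<close> are at most \<open>2 M\<close> apart, so contraction by \<open>e / (3 M)\<close> brings them within \<open>e\<close>.\<close>
      then have "0 < e / (3 * M)" using M by simp
      from expanding_inverse_contracts[OF ex inv this]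
      obtain k where k: "\<And>y. norm (?g k y) \<le> e / (3 * M) * norm y"
        by (auto simp: eventually_sequentially)
      have "?f k x \<in> (\<Union>d\<in>digit_sums A D k. (+) d ` T)"
        using x funpow_image_self_affine[OF sa, of k] by blast
      then obtain d y where d: "d \<in> digit_sums A D k" "y \<in> T" "?f k x = d + y" by auto
      have sub: "?g k ` ((+) d ` T) \<subseteq> T"
      proof -
        have "(+) d ` T \<subseteq> ?f k ` T" using d(1) funpow_image_self_affine[OF sa, of k] by blast
        then have "?g k ` ((+) d ` T) \<subseteq> ?g k ` (?f k ` T)" by blast
        also have "\<dots> = T" by (simp add: image_image funpow_matrix_inv[OF inv])
        finally show ?thesis .
      qed
      have surj: "surj (?g k)" by (metis funpow_matrix_inv(1)[OF inv] surjI)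
      have "open (?g k ` ((+) d ` interior T))"
        by (intro open_surjective_linear_image lg surj open_translation open_interior)
      moreover have "?g k ` ((+) d ` interior T) \<subseteq> T" using sub interior_subset by blast
      ultimately have "?g k (d + c) \<in> interior T" using c
        by (meson imageI interior_maximal subsetD)
      moreover have "dist (?g k (d + c)) x < e"
      proof -
        have "?g k (d + c) - x = ?g k (d + c) - ?g k (?f k x)" by (simp add: funpow_matrix_inv[OF inv])
        also have "\<dots> = ?g k (c - y)" unfolding d by (simp flip: linear_diff[OF lg])
        finally have "norm (?g k (d + c) - x) \<le> e / (3 * M) * norm (c - y)" using k by simp
        also have "\<dots> \<le> e / (3 * M) * (2 * M)"
        proof (rule mult_left_mono)
          show "norm (c - y) \<le> 2 * M"
            using M(2)[of c] M(2)[of y] c d(2) interior_subset norm_triangle_ineq4[of c y] by force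
        qed (use M e in simp)
        also have "\<dots> < e" using M e by simp
        finally show ?thesis by (simp add: dist_norm)
      qed
      ultimately show "\<exists>y\<in>interior T. dist y x < e" by blast
    qed
  qed
qed

section \<open>Cones, germs and hyperplanes\<close>

text \<open>
On a pointed polyhedral cone some linear functional is positive off the apex; \<open>b\<close> represents it.
\<close>

definition pointed_by :: "'a::real_inner \<Rightarrow> 'a set \<Rightarrow> bool" where
  "pointed_by b K \<longleftrightarrow> (\<forall>x\<in>K. x \<noteq> 0 \<longrightarrow> 0 < b \<bullet> x)"

definition germ_at :: "'a::real_normed_vector set \<Rightarrow> 'a \<Rightarrow> 'a set \<Rightarrow> bool" where
  "germ_at T y K \<longleftrightarrow> (\<exists>\<rho>>0. \<forall>z. norm z < \<rho> \<longrightarrow> (y + z \<in> T \<longleftrightarrow> z \<in> K))"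

definition hyperplane_coverable :: "'a::real_inner set \<Rightarrow> bool" where
  "hyperplane_coverable S \<longleftrightarrow>
     (\<exists>H. finite H \<and> (\<forall>(a, c)\<in>H. a \<noteq> 0) \<and> S \<subseteq> (\<Union>(a, c)\<in>H. {x. a \<bullet> x = c}))"

lemma convex_cone_hull_indexed:
  fixes a :: "'i \<Rightarrow> 'a::real_vector"
  assumes "finite I"
  shows "convex_cone hull (a ` I) = {\<Sum>i\<in>I. l i *\<^sub>R a i | l. \<forall>i\<in>I. 0 \<le> l i}"
proof
  let ?R = "{\<Sum>i\<in>I. l i *\<^sub>R a i | l. \<forall>i\<in>I. 0 \<le> l i}"
  show "convex_cone hull (a ` I) \<subseteq> ?R"
  proof (rule hull_minimal)
    show "a ` I \<subseteq> ?R"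
    proof
      fix x assume "x \<in> a ` I"
      then obtain i where i: "i \<in> I" "x = a i" by blast
      have "(\<Sum>j\<in>I. (if j = i then 1 else 0) *\<^sub>R a j) = a i"
        using assms i by (subst sum.remove[of _ i]) (auto intro!: sum.neutral)
      then show "x \<in> ?R" using i by (auto intro!: exI[of _ "\<lambda>j. if j = i then 1 else 0"])
    qed
    show "convex_cone ?R"
      unfolding convex_cone_iff
    proof (intro conjI ballI allI impI)
      show "0 \<in> ?R" by (auto intro!: exI[of _ "\<lambda>_. 0"])
      fix x assume "x \<in> ?R"
      then obtain l where l: "x = (\<Sum>i\<in>I. l i *\<^sub>R a i)" "\<forall>i\<in>I. 0 \<le> l i" by blast
      show "c *\<^sub>R x \<in> ?R" if "0 \<le> c" for c
        using l that by (auto simp: scaleR_sum_right intro!: exI[of _ "\<lambda>i. c * l i"])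
      fix y assume "y \<in> ?R"
      then obtain m where m: "y = (\<Sum>i\<in>I. m i *\<^sub>R a i)" "\<forall>i\<in>I. 0 \<le> m i" by blast
      show "x + y \<in> ?R"
        using l m by (auto simp: scaleR_add_left sum.distrib intro!: exI[of _ "\<lambda>i. l i + m i"])
    qed
  qed
  show "?R \<subseteq> convex_cone hull (a ` I)"
  proof clarify
    fix l :: "'i \<Rightarrow> real" assume l: "\<forall>i\<in>I. 0 \<le> l i"
    show "(\<Sum>i\<in>I. l i *\<^sub>R a i) \<in> convex_cone hull (a ` I)"
      using assms l
    proof (induction I rule: finite_induct)
      case empty
      then show ?case by (simp add: convex_cone_hull_contains_0)
    next
      case (insert i I)
      have "convex_cone hull (a ` I) \<subseteq> convex_cone hull (a ` insert i I)" by (rule hull_mono) blast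
      moreover have "a i \<in> convex_cone hull (a ` insert i I)" by (rule hull_inc) blast
      ultimately show ?case using insert
        by (auto intro!: convex_cone_hull_add convex_cone_hull_mul)
    qed
  qed
qed

lemma pointed_by_convex_cone_hull:
  assumes "finite E" "\<And>e. e \<in> E \<Longrightarrow> 0 < b \<bullet> e"
  shows "pointed_by b (convex_cone hull E)"
  unfolding pointed_by_def
proof (intro ballI impI)
  fix x assume x: "x \<in> convex_cone hull E" "x \<noteq> 0"
  then obtain l where l: "x = (\<Sum>e\<in>E. l e *\<^sub>R e)" "\<forall>e\<in>E. 0 \<le> l e"
    using convex_cone_hull_indexed[OF assms(1), of "\<lambda>e. e"] by auto
  then obtain e where e: "e \<in> E" "l e \<noteq> 0" using x(2) by (metis (no_types, lifting) scaleR_zero_left sum.neutral)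
  have "b \<bullet> x = (\<Sum>e\<in>E. l e * (b \<bullet> e))" by (simp add: l inner_sum_right)
  also have "\<dots> > 0"
    using e l(2) assms by (intro sum_pos2[of _ e]) (auto intro!: mult_nonneg_nonneg less_imp_le simp: less_le)
  finally show "0 < b \<bullet> x" .
qed

lemma pointed_by_nonneg: "pointed_by b K \<Longrightarrow> x \<in> K \<Longrightarrow> 0 \<le> b \<bullet> x"
  by (cases "x = 0") (auto simp: pointed_by_def less_imp_le)

lemma pointed_by_sum_zero:
  assumes "pointed_by b K" "x \<in> K" "y \<in> K" "x + y = 0"
  shows "x = 0" "y = 0"
proof -
  have "b \<bullet> x + b \<bullet> y = 0" using assms(4) by (simp flip: inner_add_right)
  then show "x = 0" "y = 0"
    using assms(1-3) pointed_by_nonneg[OF assms(1)] unfolding pointed_by_def by (smt (verit))+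
qed

lemma conic_eq_if_common_germ:
  fixes K L :: "'a::real_normed_vector set"
  assumes K: "conic K" and L: "conic L" and g: "germ_at T y K" "germ_at T y L"
  shows "K = L"
proof -
  obtain r where r: "r > 0" "\<And>z. norm z < r \<Longrightarrow> (z \<in> K \<longleftrightarrow> z \<in> L)"
    using g unfolding germ_at_def by (metis (no_types, lifting) min_less_iff_conj)
  have sub: "x \<in> Q" if "conic P" "conic Q" "\<And>z. norm z < r \<Longrightarrow> z \<in> P \<Longrightarrow> z \<in> Q" "x \<in> P" for P Q x
  proof -
    define c where "c = r / (2 * (norm x + 1))"
    have c: "c > 0" unfolding c_def using r(1) by (intro divide_pos_pos) (auto intro: add_nonneg_pos)
    have "c * norm x \<le> c * (norm x + 1)" using c by simp
    also have "\<dots> = r / 2" unfolding c_def by (simp add: field_simps add_nonneg_eq_0_iff)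
    finally have "norm (c *\<^sub>R x) < r" using c r(1) by simp
    moreover have "c *\<^sub>R x \<in> P" using that c by (simp add: conic_mul)
    ultimately have "c *\<^sub>R x \<in> Q" using that by blast
    then have "(1/c) *\<^sub>R (c *\<^sub>R x) \<in> Q" 
      using conic_mul[OF \<open>conic Q\<close>, of "c *\<^sub>R x" "1/c"] c by simp
    then show ?thesis using c by simp
  qed
  show ?thesis using sub[OF K L] sub[OF L K] r(2) by blast
qed

lemma hyperplane_coverable_empty: "hyperplane_coverable {}"
  unfolding hyperplane_coverable_def by (rule exI[of _ "{}"]) auto

lemma hyperplane_coverable_mono: "hyperplane_coverable S \<Longrightarrow> R \<subseteq> S \<Longrightarrow> hyperplane_coverable R"
  unfolding hyperplane_coverable_def by (meson subset_trans)

lemma hyperplane_coverable_Un: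
  assumes "hyperplane_coverable S" "hyperplane_coverable R"
  shows "hyperplane_coverable (S \<union> R)"
proof -
  obtain H where H: "finite H" "\<forall>(a, c)\<in>H. a \<noteq> 0" "S \<subseteq> (\<Union>(a, c)\<in>H. {x. a \<bullet> x = c})"
    using assms(1) unfolding hyperplane_coverable_def by blast
  obtain G where G: "finite G" "\<forall>(a, c)\<in>G. a \<noteq> 0" "R \<subseteq> (\<Union>(a, c)\<in>G. {x. a \<bullet> x = c})"
    using assms(2) unfolding hyperplane_coverable_def by blast
  show ?thesis unfolding hyperplane_coverable_def
    by (rule exI[of _ "H \<union> G"]) (use H G in auto)
qed

lemma hyperplane_coverable_UN:
  "finite P \<Longrightarrow> (\<And>p. p \<in> P \<Longrightarrow> hyperplane_coverable (S p)) \<Longrightarrow> hyperplane_coverable (\<Union>p\<in>P. S p)"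
  by (induction P rule: finite_induct) (auto simp: hyperplane_coverable_empty hyperplane_coverable_Un)

lemma hyperplane_coverable_translation:
  assumes "hyperplane_coverable S"
  shows "hyperplane_coverable ((+) t ` S)"
proof -
  obtain H where H: "finite H" "\<forall>(a, c)\<in>H. a \<noteq> 0" "S \<subseteq> (\<Union>(a, c)\<in>H. {x. a \<bullet> x = c})"
    using assms unfolding hyperplane_coverable_def by blast
  show ?thesis unfolding hyperplane_coverable_def
    by (rule exI[of _ "(\<lambda>(a, c). (a, a \<bullet> t + c)) ` H"])
      (use H in \<open>force simp: inner_add_right\<close>)
qed

text \<open>
A point of a polyhedron at which all defining inequalities are strict is interior.
\<close>

lemma hyperplane_coverable_frontier_polyhedron:
  fixes K :: "'a::euclidean_space set"
  assumes "polyhedron K"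
  shows "hyperplane_coverable (frontier K)"
proof -
  obtain F where F: "finite F" "K = \<Inter>F" "\<forall>h\<in>F. \<exists>a b. a \<noteq> 0 \<and> h = {x. a \<bullet> x \<le> b}"
    using assms unfolding polyhedron_def by blast
  then obtain a b where "\<And>h. h \<in> F \<Longrightarrow> a h \<noteq> 0 \<and> h = {x. a h \<bullet> x \<le> b h}" by metis
  then have a0: "\<And>h. h \<in> F \<Longrightarrow> a h \<noteq> 0"
    and ab: "\<And>h x. h \<in> F \<Longrightarrow> x \<in> h \<longleftrightarrow> a h \<bullet> x \<le> b h" by blast+
  show ?thesis unfolding hyperplane_coverable_def
  proof (intro exI[of _ "(\<lambda>h. (a h, b h)) ` F"] conjI)
    show "frontier K \<subseteq> (\<Union>(a, c)\<in>(\<lambda>h. (a h, b h)) ` F. {x. a \<bullet> x = c})"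
    proof
      fix x assume x: "x \<in> frontier K"
      then have xK: "x \<in> K" "x \<notin> interior K"
        using polyhedron_imp_closed[OF assms] by (auto simp: frontier_def)
      show "x \<in> (\<Union>(a, c)\<in>(\<lambda>h. (a h, b h)) ` F. {x. a \<bullet> x = c})"
      proof (rule ccontr)
        assume "\<not> ?thesis"
        then have lt: "\<forall>h\<in>F. a h \<bullet> x < b h" using xK(1) ab F(2) by (fastforce simp: less_le)
        have "open (\<Inter>h\<in>F. {x. a h \<bullet> x < b h})"
          using F(1) by (intro open_INT) (auto simp: open_halfspace_lt)
        moreover have "(\<Inter>h\<in>F. {x. a h \<bullet> x < b h}) \<subseteq> K"
          unfolding F(2) using ab by (auto intro: less_imp_le)
        ultimately have "(\<Inter>h\<in>F. {x. a h \<bullet> x < b h}) \<subseteq> interior K" by (rule interior_maximal[rotated])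
        then show False using lt xK(2) by blast
      qed
    qed
  qed (use F(1) a0 in auto)
qed

lemma finite_hyperplanes_avoided_by_open:
  fixes U :: "'a::euclidean_space set"
  assumes "open U" "U \<noteq> {}" "finite H" "\<forall>(a, c)\<in>H. a \<noteq> 0"
  obtains z where "z \<in> U" "\<forall>(a, c)\<in>H. a \<bullet> z \<noteq> c"
proof -
  have "negligible (\<Union>(a, c)\<in>H. {x. a \<bullet> x = c})"
    using assms by (intro negligible_Union finite_imageI) (auto intro!: negligible_hyperplane)
  then have "\<not> U \<subseteq> (\<Union>(a, c)\<in>H. {x. a \<bullet> x = c})"
    using open_not_negligible[OF assms(1,2)] negligible_subset by blast
  then show ?thesis using that by auto
qed

text \<open>
A strict minimizer \<open>y\<close> of a linear functional on \<open>T\<close> is determined by the covering hyperplanes that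
pass through it. If two of them, \<open>y\<close> and \<open>y'\<close>, lie on the same hyperplanes, then all of these are
parallel to \<open>w = y' - y\<close>. Near \<open>y\<close> there are no other hyperplanes, so a short segment in
direction \<open>w\<close> through a generic point of \<open>T\<close> misses the frontier and stays in \<open>T\<close>. In the limit \<open>T\<close>
contains a segment with \<open>y\<close> in its relative interior, and \<open>y\<close> is no strict minimizer.
\<close>

lemma finite_strict_minimizers:
  fixes T :: "'a::euclidean_space set"
  assumes reg: "closure (interior T) = T" and cov: "hyperplane_coverable (frontier T)"
  shows "finite {y \<in> T. \<exists>b. \<forall>x\<in>T. x \<noteq> y \<longrightarrow> b \<bullet> y < b \<bullet> x}"
proof -
  obtain H where H: "finite H" "\<forall>(a, c)\<in>H. a \<noteq> 0" "frontier T \<subseteq> (\<Union>(a, c)\<in>H. {x. a \<bullet> x = c})"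
    using cov unfolding hyperplane_coverable_def by blast
  let ?Y = "{y \<in> T. \<exists>b. \<forall>x\<in>T. x \<noteq> y \<longrightarrow> b \<bullet> y < b \<bullet> x}"
  define thru where "thru y = {(a, c)\<in>H. a \<bullet> y = c}" for y
  have clT: "closed T" using reg by (metis closed_closure)
  have "inj_on thru ?Y"
  proof (rule inj_onI, rule ccontr)
    fix y y' assume y: "y \<in> ?Y" and y': "y' \<in> ?Y" and eq: "thru y = thru y'" and ne: "y \<noteq> y'"
    define w where "w = y' - y"
    have w: "w \<noteq> 0" using ne by (simp add: w_def)
    have aw: "a \<bullet> w = 0" if "(a, c) \<in> thru y" for a c
    proof -
      have "(a, c) \<in> thru y'" using that eq by simp
      then show ?thesis using that by (simp add: w_def thru_def inner_diff_right)
    qed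
    from y obtain b where b: "\<forall>x\<in>T. x \<noteq> y \<longrightarrow> b \<bullet> y < b \<bullet> x" and yT: "y \<in> T" by blast
    have "open (\<Inter>(a, c)\<in>H - thru y. {x. a \<bullet> x \<noteq> c})"
      using H(1) by (intro open_INT) (auto intro!: open_Collect_neq continuous_intros)
    moreover have "y \<in> (\<Inter>(a, c)\<in>H - thru y. {x. a \<bullet> x \<noteq> c})" by (auto simp: thru_def)
    ultimately obtain \<rho> where \<rho>: "\<rho> > 0" "ball y \<rho> \<subseteq> (\<Inter>(a, c)\<in>H - thru y. {x. a \<bullet> x \<noteq> c})"
      using open_contains_ball by meson
    define \<sigma> where "\<sigma> = \<rho> / (2 * norm w)"
    have \<sigma>: "\<sigma> > 0" "norm (\<sigma> *\<^sub>R w) = \<rho> / 2" using \<rho>(1) w by (auto simp: \<sigma>_def)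
    have key: "y + s *\<^sub>R w \<in> T" if s: "\<bar>s\<bar> \<le> \<sigma>" for s
    proof -
      have "y + s *\<^sub>R w \<in> closure T"
        unfolding closure_approachable
      proof (intro allI impI)
        fix e :: real assume e: "e > 0"
        have "y \<in> closure (interior T)" using yT reg by simp
        then obtain u where u: "u \<in> interior T" "dist u y < min e (\<rho>/2)"
          using \<rho>(1) e unfolding closure_approachable by (metis half_gt_zero min_less_iff_conj)
        have "open (interior T \<inter> ball y (min e (\<rho>/2)))" by (intro open_Int) auto
        moreover have "interior T \<inter> ball y (min e (\<rho>/2)) \<noteq> {}"
          using u by (auto simp: dist_commute)
        ultimately obtain z where z: "z \<in> interior T \<inter> ball y (min e (\<rho>/2))" "\<forall>(a, c)\<in>H. a \<bullet> z \<noteq> c"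
          using finite_hyperplanes_avoided_by_open H(1,2) by metis
        let ?seg = "closed_segment z (z + s *\<^sub>R w)"
        have "?seg \<inter> frontier T = {}"
        proof (rule ccontr)
          assume "?seg \<inter> frontier T \<noteq> {}"
          then obtain p where p: "p \<in> ?seg" "p \<in> frontier T" by blast
          then obtain a c where ac: "(a, c) \<in> H" "a \<bullet> p = c" using H(3) by auto
          obtain q where q: "0 \<le> q" "q \<le> 1" "p = (1 - q) *\<^sub>R z + q *\<^sub>R (z + s *\<^sub>R w)"
            using p(1) by (auto simp: in_segment)
          then have pz: "p = z + (q * s) *\<^sub>R w" by (simp add: algebra_simps)
          show False
          proof (cases "(a, c) \<in> thru y")
            case True
            then have "a \<bullet> p = a \<bullet> z" by (simp add: pz inner_add_right aw)
            then show False using z(2) ac by auto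
          next
            case False
            have "norm (p - y) \<le> norm (z - y) + norm ((q * s) *\<^sub>R w)"
              unfolding pz by (metis add_diff_eq add.commute norm_triangle_ineq)
            also have "norm (z - y) < \<rho> / 2" using z(1) by (simp add: dist_norm norm_minus_commute)
            also have "norm ((q * s) *\<^sub>R w) \<le> norm (\<sigma> *\<^sub>R w)"
            proof -
              have "\<bar>q * s\<bar> \<le> \<bar>\<sigma>\<bar>"
                using mult_mono[of q 1 "\<bar>s\<bar>" \<sigma>] q(1,2) s \<sigma>(1) by (simp add: abs_mult)
              then show ?thesis by (simp add: mult_right_mono)
            qed
            finally have "p \<in> ball y \<rho>" using \<sigma>(2) by (simp add: dist_norm norm_minus_commute)
            then have "p \<in> (\<Inter>(a, c)\<in>H - thru y. {x. a \<bullet> x \<noteq> c})" using \<rho>(2) by blast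
            then show False using False ac by auto
          qed
        qed
        moreover have "z \<in> ?seg \<inter> T" using z(1) interior_subset by auto
        ultimately have "?seg \<subseteq> T" using connected_Int_frontier[of ?seg T] by auto
        then have "z + s *\<^sub>R w \<in> T" by auto
        moreover have "dist (z + s *\<^sub>R w) (y + s *\<^sub>R w) < e" using z(1) by (simp add: dist_commute)
        ultimately show "\<exists>x\<in>T. dist x (y + s *\<^sub>R w) < e" by blast
      qed
      then show ?thesis using clT by simp
    qed
    have ne: "y + s *\<^sub>R w \<noteq> y" if "s \<noteq> 0" for s using w that by simp
    have "0 < b \<bullet> (\<sigma> *\<^sub>R w)" "0 < b \<bullet> ((- \<sigma>) *\<^sub>R w)"
      using b[rule_format, OF key ne, of \<sigma>] b[rule_format, OF key ne, of "- \<sigma>"] \<sigma>(1)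
      by (auto simp: inner_add_right inner_diff_right)
    then show False by simp
  qed
  moreover have "finite (thru ` ?Y)"
    by (rule finite_subset[of _ "Pow H"]) (use H(1) in \<open>auto simp: thru_def\<close>)
  ultimately show ?thesis using finite_imageD by blast
qed

section \<open>Tiled patches of pointed cones\<close>

text \<open>
A frontier point \<open>x\<close> of \<open>T\<close> in the interior of the cone must be covered by another tile \<open>t + T\<close>, and it is a
frontier point of that tile. Then \<open>x - t\<close> is again a frontier point of \<open>T\<close>, and its height \<open>b \<bullet> (x - t)\<close>
is smaller by at least a fixed \<open>\<delta> > 0\<close>. After finitely many such steps the frontier of the cone is
reached. Only a patch of radius \<open>R\<close> of the tiling is needed, because \<open>t\<close> stays bounded.
\<close>

lemma frontier_subset_cone_frontier_translates:
  fixes T K :: "'a::euclidean_space set"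
  assumes K: "closed K" "pointed_by b K" and TK: "T \<subseteq> K" "0 \<in> T"
    and reg: "closure (interior T) = T"
    and J: "finite J"
    and bound: "\<And>x. x \<in> T \<Longrightarrow> norm x < M" and R: "2 * M \<le> R"
    and cover: "\<And>z. norm z < R \<Longrightarrow> z \<in> K \<longleftrightarrow> z \<in> (\<Union>t\<in>J. (+) t ` T)"
    and disj: "\<And>t. t \<in> J \<Longrightarrow> t \<noteq> 0 \<Longrightarrow> interior T \<inter> interior ((+) t ` T) = {}"
  obtains P where "finite P" "frontier T \<subseteq> (\<Union>p\<in>P. (+) p ` frontier K)"
proof -
  have clT: "closed T" using reg by (metis closed_closure)
  have M: "0 < M" using bound[OF TK(2)] by simp
  define L where "L = {t\<in>J. t \<noteq> 0 \<and> t \<in> K}"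
  have fL: "finite L" using J by (simp add: L_def)
  have step: "x \<in> frontier K \<or> (\<exists>t\<in>L. x - t \<in> frontier T)" if x: "x \<in> frontier T" for x
  proof (rule disjCI)
    assume "\<not> (\<exists>t\<in>L. x - t \<in> frontier T)"
    show "x \<in> frontier K"
    proof (rule ccontr)
      assume nf: "x \<notin> frontier K"
      have xT: "x \<in> T" "x \<notin> interior T" using x clT by (auto simp: frontier_def)
      then have xK: "x \<in> interior K" using nf TK(1) K(1) by (auto simp: frontier_def)
      have nx: "norm x < R" using bound[OF xT(1)] R M by simp
      let ?O = "\<Union>t\<in>J - {0}. (+) t ` T"
      have clO: "closed ?O" using J clT by (auto intro!: closed_UN closed_translation)
      have "x \<in> ?O"
      proof (rule ccontr)
        assume "x \<notin> ?O"
        then have "x \<in> interior K \<inter> ball 0 R \<inter> - ?O" using xK nx by simp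
        moreover have "open (interior K \<inter> ball 0 R \<inter> - ?O)"
          using clO by (intro open_Int open_Compl) auto
        moreover have "interior K \<inter> ball 0 R \<inter> - ?O \<subseteq> T"
        proof
          fix z assume z: "z \<in> interior K \<inter> ball 0 R \<inter> - ?O"
          then have "z \<in> K" "norm z < R" using interior_subset by auto
          then obtain t where "t \<in> J" "z \<in> (+) t ` T" using cover by blast
          then show "z \<in> T" using z by (cases "t = 0") auto
        qed
        ultimately show False using xT(2) interior_maximal by blast
      qed
      then obtain t where t: "t \<in> J" "t \<noteq> 0" "x \<in> (+) t ` T" by blast
      have "norm t < R"
      proof -
        obtain s where "s \<in> T" "x = t + s" using t(3) by blast
        then show ?thesis using bound[of s] bound[OF xT(1)] R norm_triangle_ineq4[of x s] by simp
      qed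
      moreover have "t \<in> (+) t ` T" using TK(2) by force
      ultimately have "t \<in> K" using cover t(1) by blast
      then have tL: "t \<in> L" using t by (simp add: L_def)
      have "x \<notin> interior ((+) t ` T)"
      proof
        assume "x \<in> interior ((+) t ` T)"
        moreover have "x \<in> closure (interior T)" using xT reg by simp
        ultimately show False
          using disj[OF t(1,2)] open_Int_closure_eq_empty[of "interior ((+) t ` T)" "interior T"]
          by (auto simp: Int_commute)
      qed
      then have "x - t \<notin> interior T" by (auto simp: interior_translation image_iff)
      moreover have "x - t \<in> T" using t(3) by auto
      ultimately have "x - t \<in> frontier T" using clT by (simp add: frontier_def)
      then show False using tL \<open>\<not> (\<exists>t\<in>L. x - t \<in> frontier T)\<close> by blast
    qed
  qed
  define \<delta> where "\<delta> = (if L = {} then 1 else Min ((\<lambda>t. b \<bullet> t) ` L))"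
  have \<delta>: "\<delta> > 0" "\<And>t. t \<in> L \<Longrightarrow> \<delta> \<le> b \<bullet> t"
    using fL K(2) by (auto simp: \<delta>_def L_def pointed_by_def)
  have ind: "\<exists>P. finite P \<and> {x \<in> frontier T. b \<bullet> x < real j * \<delta>} \<subseteq> (\<Union>p\<in>P. (+) p ` frontier K)" for j
  proof (induction j)
    case 0
    have "0 \<le> b \<bullet> x" if "x \<in> frontier T" for x
      using that clT TK pointed_by_nonneg[OF K(2)] by (auto simp: frontier_def)
    then show ?case by (intro exI[of _ "{}"]) force
  next
    case (Suc j)
    then obtain P where P: "finite P"
      "{x \<in> frontier T. b \<bullet> x < real j * \<delta>} \<subseteq> (\<Union>p\<in>P. (+) p ` frontier K)" by blast
    let ?P = "insert 0 ((\<lambda>(t, p). t + p) ` (L \<times> P))"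
    have "x \<in> (\<Union>p\<in>?P. (+) p ` frontier K)" if x: "x \<in> frontier T" "b \<bullet> x < real (Suc j) * \<delta>" for x
      using step[OF x(1)]
    proof
      assume "\<exists>t\<in>L. x - t \<in> frontier T"
      then obtain t where t: "t \<in> L" "x - t \<in> frontier T" by blast
      have "b \<bullet> (x - t) < real j * \<delta>" using \<delta>(2)[OF t(1)] x(2) by (simp add: inner_diff_right algebra_simps)
      then obtain p y where p: "p \<in> P" "y \<in> frontier K" "x - t = p + y" using P(2) t(2) by blast
      then have "x = (t + p) + y" by (simp add: algebra_simps)
      then show ?thesis using p t by blast
    qed auto
    then have "{x \<in> frontier T. b \<bullet> x < real (Suc j) * \<delta>} \<subseteq> (\<Union>p\<in>?P. (+) p ` frontier K)" by blast
    then show ?case using P(1) fL by (intro exI[of _ ?P]) simp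
  qed
  obtain j where j: "norm b * M < real j * \<delta>" using reals_Archimedean3[OF \<delta>(1)] by blast
  have "b \<bullet> x < real j * \<delta>" if "x \<in> frontier T" for x
  proof -
    have "x \<in> T" using that clT by (auto simp: frontier_def)
    then have "norm x \<le> M" using bound less_imp_le by blast
    then have "b \<bullet> x \<le> norm b * M" using norm_cauchy_schwarz[of b x] mult_left_mono[of "norm x" M "norm b"] by simp
    then show ?thesis using j by simp
  qed
  then show ?thesis using ind[of j] that by (auto simp: subset_iff)
qed

text \<open>
Two tiles that both contain the apex \<open>0\<close> of a pointed cone are \<open>T - y\<close> and \<open>T - z\<close> with \<open>y, z \<in> T\<close>;
both lie in the cone, so \<open>y - z\<close> and \<open>z - y\<close> do, and \<open>y = z\<close>. As exactly one tile contains the apex,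
this tile must fill the cone near \<open>0\<close> alone.
\<close>

lemma apex_of_cone_patch:
  fixes T K :: "'a::euclidean_space set"
  assumes K: "convex_cone K" "pointed_by b K" and T: "compact T"
    and J: "finite J" and diam: "\<And>x y. x \<in> T \<Longrightarrow> y \<in> T \<Longrightarrow> dist x y < R" and R: "0 < R"
    and cover: "\<And>z. norm z < R \<Longrightarrow> z \<in> K \<longleftrightarrow> z \<in> (\<Union>t\<in>J. (+) t ` T)"
  obtains y where "y \<in> T" "- y \<in> J" "\<And>x. x \<in> T \<Longrightarrow> x - y \<in> K" "germ_at T y K"
proof -
  have "0 \<in> (\<Union>t\<in>J. (+) t ` T)" using cover[of 0] R convex_cone_contains_0[OF K(1)] by simp
  then obtain y where y: "y \<in> T" "- y \<in> J" by (auto simp: image_iff) (metis add.commute add_eq_0_iff)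
  have sub: "x - z \<in> K" if "z \<in> T" "- z \<in> J" "x \<in> T" for x z
  proof -
    have "x - z \<in> (+) (- z) ` T" using that by auto
    moreover have "norm (x - z) < R" using diam that by (simp add: dist_norm)
    ultimately show ?thesis using cover that(2) by blast
  qed
  let ?O = "\<Union>t\<in>J - {- y}. (+) t ` T"
  have "closed ?O" using J compact_imp_closed[OF T] by (auto intro!: closed_UN closed_translation)
  moreover have "0 \<notin> ?O"
  proof
    assume "0 \<in> ?O"
    then obtain z where z: "z \<in> T" "- z \<in> J" "z \<noteq> y"
      by (auto simp: image_iff) (metis add.inverse_inverse add_eq_0_iff)
    have "y - z \<in> K" "z - y \<in> K" using sub y z by blast+
    then show False using pointed_by_sum_zero[OF K(2), of "y - z" "z - y"] z(3) by simp
  qed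
  ultimately have "open (- ?O \<inter> ball 0 R)" "0 \<in> - ?O \<inter> ball 0 R"
    using R by (blast intro: open_Int open_Compl open_ball, simp)
  then obtain \<rho> where \<rho>: "\<rho> > 0" "ball 0 \<rho> \<subseteq> - ?O \<inter> ball 0 R"
    by (meson open_contains_ball)
  have "germ_at T y K"
    unfolding germ_at_def
  proof (intro exI[of _ \<rho>] conjI allI impI)
    fix z :: 'a assume "norm z < \<rho>"
    then have "z \<in> ball 0 \<rho>" by simp
    then have "z \<in> - ?O \<inter> ball 0 R" by (rule subsetD[OF \<rho>(2)])
    then have z: "z \<notin> ?O" "norm z < R" by simp_all
    have "z \<in> K \<longleftrightarrow> z \<in> (\<Union>t\<in>J. (+) t ` T)" using cover z(2) by blast
    also have "\<dots> \<longleftrightarrow> z \<in> (+) (- y) ` T" using z(1) y(2) by blast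
    also have "\<dots> \<longleftrightarrow> y + z \<in> T" by (auto simp: image_iff intro!: bexI[of _ "y + z"])
    finally show "y + z \<in> T \<longleftrightarrow> z \<in> K" by simp
  qed (rule \<rho>(1))
  then show ?thesis using that y sub by blast
qed

lemma interior_Int_empty_if_negligible:
  fixes S :: "'a::euclidean_space set"
  assumes "negligible (S \<inter> R)"
  shows "interior S \<inter> interior R = {}"
  by (metis assms interior_Int interior_subset negligible_subset open_interior open_not_negligible)

lemma convex_polyhedral_coneE:
  fixes C :: "(real^'n) set"
  assumes "convex_polyhedral_cone C"
  obtains E b where "finite E" "\<And>e. e \<in> E \<Longrightarrow> 0 < b \<bullet> e" "C = convex_cone hull E"
proof -
  obtain k :: nat and a :: "nat \<Rightarrow> real^'n" and b where a: "\<forall>j\<in>{1..k}. a j \<bullet> b > 0"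
    "C = {(\<Sum>j=1..k. l j *\<^sub>R a j) | l :: nat \<Rightarrow> real. \<forall>j\<in>{1..k}. l j \<ge> 0}"
    using assms unfolding convex_polyhedral_cone_def by blast
  have "C = convex_cone hull (a ` {1..k})" unfolding a(2) by (rule convex_cone_hull_indexed[symmetric]) simp
  then show ?thesis using that[of "a ` {1..k}" b] a(1) by (metis finite_atLeastAtMost finite_imageI imageE inner_commute)
qed

text \<open>
Near \<open>A\<^sup>k x0\<close> the set \<open>A\<^sup>k T\<close> is the cone \<open>A\<^sup>k C\<close>, on a ball whose radius tends to infinity with \<open>k\<close>, and it
is a union of copies of \<open>T\<close>. Once the radius exceeds a bound that depends only on \<open>T\<close>, both
\<open>apex_of_cone_patch\<close> and \<open>frontier_subset_cone_frontier_translates\<close> apply to this patch of \<open>A\<^sup>k C\<close>. The apex \<open>y\<close> found in \<open>T\<close> may change with \<open>k\<close>.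
\<close>

lemma tiled_patch_at_corner:
  fixes A :: "real^'n^'n"
  assumes tile: "self_affine_tile A D T"
    and x0: "germ_at T x0 C" and C: "C = convex_cone hull E" "finite E" "\<And>e. e \<in> E \<Longrightarrow> 0 < b \<bullet> e"
  shows "\<forall>\<^sub>F k in sequentially. \<exists>y b' P. y \<in> T \<and> (\<forall>x\<in>T. x - y \<in> ((*v) A ^^ k) ` C) \<and>
      pointed_by b' (((*v) A ^^ k) ` C) \<and> germ_at T y (((*v) A ^^ k) ` C) \<and>
      finite P \<and> frontier T \<subseteq> (\<Union>p\<in>P. (+) p ` frontier (((*v) A ^^ k) ` C))"
proof -
  have sa: "self_affine_set A D T" and cT: "compact T" and ex: "expanding A" and fD: "finite D"
    using tile by (auto simp: self_affine_tile_def self_affine_set_def)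
  note inv = image_eq_of_self_affine(1)[OF sa]
  note reg = self_affine_tile_regular_closed[OF tile]
  let ?f = "\<lambda>k. (*v) A ^^ k" and ?g = "\<lambda>k. (*v) (matrix_inv A) ^^ k"
  have lf: "linear (?f k)" and lg: "linear (?g k)" for k by (intro linear_funpow; simp)+
  obtain r where r: "0 < r" "\<And>z. norm z < r \<Longrightarrow> x0 + z \<in> T \<longleftrightarrow> z \<in> C"
    using x0 unfolding germ_at_def by blast
  obtain M where M: "0 < M" "\<And>x. x \<in> T \<Longrightarrow> norm x \<le> M"
    using compact_imp_bounded[OF cT] by (auto simp: bounded_pos)
  \<comment> \<open>The tile translated to the apex has points of norm below \<open>4 M\<close>, and a patch of twice that radius is
    needed.\<close>
  define R where "R = 8 * M"
  have R: "0 < R" using M by (simp add: R_def)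
  have "0 < r / R" using r R by simp
  from expanding_inverse_contracts[OF ex inv this] show ?thesis
  proof eventually_elim
    case (elim k)
    let ?K = "?f k ` C"
    have K_hull: "?K = convex_cone hull (?f k ` E)"
      unfolding C(1) by (rule convex_cone_hull_linear_image[OF lf, symmetric])
    \<comment> \<open>The functional \<open>x \<mapsto> b \<bullet> A\<^bsup>-k\<^esup> x\<close>, which is positive on \<open>A\<^sup>k C\<close>.\<close>
    define b' where "b' = adjoint (?g k) b"
    have b': "b' \<bullet> ?f k e = b \<bullet> e" for e
      unfolding b'_def using adjoint_clauses(2)[OF lg, of k b "?f k e"]
      by (simp add: funpow_matrix_inv[OF inv])
    have pK: "pointed_by b' ?K"
      unfolding K_hull by (rule pointed_by_convex_cone_hull) (use C b' in auto)
    have ccK: "convex_cone ?K" unfolding K_hull by (rule convex_cone_convex_cone_hull)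
    have clK: "closed ?K" unfolding K_hull by (rule closed_convex_cone_hull) (use C in simp)
    define J where "J = (\<lambda>d. d - ?f k x0) ` digit_sums A D k"
    have fJ: "finite J" using finite_digit_sums[OF fD] by (simp add: J_def)
    have cover: "z \<in> ?K \<longleftrightarrow> z \<in> (\<Union>t\<in>J. (+) t ` T)" if z: "norm z < R" for z
    proof -
      have "norm (?g k z) \<le> r / R * norm z" using elim by blast
      also have "\<dots> < r / R * R" using z r R by (intro mult_strict_left_mono) auto
      finally have nz: "norm (?g k z) < r" using R by simp
      have "z \<in> (\<Union>t\<in>J. (+) t ` T) \<longleftrightarrow> z + ?f k x0 \<in> (\<Union>d\<in>digit_sums A D k. (+) d ` T)"
        by (force simp: J_def algebra_simps image_iff)
      also have "\<dots> \<longleftrightarrow> z + ?f k x0 \<in> ?f k ` T" by (simp add: funpow_image_self_affine[OF sa])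
      also have "\<dots> \<longleftrightarrow> ?g k (z + ?f k x0) \<in> T"
        by (metis (no_types, lifting) funpow_matrix_inv[OF inv] imageE imageI)
      also have "?g k (z + ?f k x0) = x0 + ?g k z"
        by (simp add: linear_add[OF lg] funpow_matrix_inv[OF inv])
      also have "x0 + ?g k z \<in> T \<longleftrightarrow> ?g k z \<in> C" using r(2)[OF nz] .
      also have "\<dots> \<longleftrightarrow> z \<in> ?K"
        by (metis (no_types, lifting) funpow_matrix_inv[OF inv] imageE imageI)
      finally show ?thesis by simp
    qed
    have nov: "interior ((+) s ` T) \<inter> interior ((+) t ` T) = {}" if st: "s \<in> J" "t \<in> J" "s \<noteq> t" for s t
    proof -
      obtain d e where de: "d \<in> digit_sums A D k" "e \<in> digit_sums A D k" "d \<noteq> e"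
        "s = d - ?f k x0" "t = e - ?f k x0" using st by (auto simp: J_def)
      have eq: "(+) s ` T = (+) (- ?f k x0) ` (+) d ` T" "(+) t ` T = (+) (- ?f k x0) ` (+) e ` T"
        unfolding de image_image by (auto intro!: image_cong)
      have "interior ((+) d ` T) \<inter> interior ((+) e ` T) = {}"
        using negligible_overlap_digit_sums[OF sa de(1-3)] by (rule interior_Int_empty_if_negligible)
      then show ?thesis unfolding eq by (simp only: interior_translation) auto
    qed
    have diam: "dist x y < R" if "x \<in> T" "y \<in> T" for x y
      using M(2)[OF that(1)] M(2)[OF that(2)] M(1) norm_triangle_ineq4[of x y] by (simp add: dist_norm R_def)
    obtain y where y: "y \<in> T" "- y \<in> J" "\<And>x. x \<in> T \<Longrightarrow> x - y \<in> ?K" "germ_at T y ?K"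
      using apex_of_cone_patch[OF ccK pK cT fJ diam R cover] by blast
    let ?T = "(+) (- y) ` T"
    obtain P where P: "finite P" "frontier ?T \<subseteq> (\<Union>p\<in>P. (+) p ` frontier ?K)"
    proof (rule frontier_subset_cone_frontier_translates[OF clK pK, of ?T "(+) y ` J" "4 * M" R])
      show "?T \<subseteq> ?K" using y(3) by auto
      show "0 \<in> ?T" using y(1) by force
      show "closure (interior ?T) = ?T" by (simp only: interior_translation closure_translation reg)
      show "finite ((+) y ` J)" using fJ by simp
      show "norm x < 4 * M" if x: "x \<in> ?T" for x
      proof -
        obtain s where "s \<in> T" "x = s - y" using x by auto
        then show ?thesis using M(2)[of s] M(2)[OF y(1)] M(1) norm_triangle_ineq4[of s y] by simp
      qed
      show "2 * (4 * M) \<le> R" by (simp add: R_def)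
      show "z \<in> ?K \<longleftrightarrow> z \<in> (\<Union>t\<in>(+) y ` J. (+) t ` ?T)" if "norm z < R" for z
        using cover[OF that] by (simp add: image_image algebra_simps)
      show "interior ?T \<inter> interior ((+) t ` ?T) = {}" if t: "t \<in> (+) y ` J" "t \<noteq> 0" for t
      proof -
        obtain s where s: "s \<in> J" "t = y + s" using t by blast
        have "(+) t ` ?T = (+) s ` T" by (simp add: s image_image algebra_simps)
        moreover have "s \<noteq> - y" using s t by auto
        ultimately show ?thesis using nov[OF y(2) s(1)] by simp
      qed
    qed
    have "frontier T \<subseteq> (\<Union>p\<in>(+) y ` P. (+) p ` frontier ?K)"
    proof
      fix x assume "x \<in> frontier T"
      then have "- y + x \<in> frontier ?T" unfolding frontier_translation by (rule imageI)
      then have "x - y \<in> frontier ?T" by simp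
      then obtain p z where "p \<in> P" "z \<in> frontier ?K" "x - y = p + z" using P(2) by blast
      moreover from this have "x = (y + p) + z" by (simp add: algebra_simps)
      ultimately show "x \<in> (\<Union>p\<in>(+) y ` P. (+) p ` frontier ?K)" by blast
    qed
    then show ?case using y pK P(1) by blast
  qed
qed

section \<open>Tiling a cone that a power of the matrix preserves\<close>

text \<open>
The apex \<open>y k\<close> at which \<open>T\<close> looks like \<open>A\<^sup>k C\<close> is a strict minimizer of a linear functional on \<open>T\<close>,
hence one of finitely many points. Two exponents \<open>k < l\<close> share their apex, and then their cones
agree, being determined by the germ of \<open>T\<close> there: \<open>A\<^bsup>l-k\<^esup>\<close> maps the cone \<open>A\<^sup>k C\<close> onto itself.
\<close>

lemma invariant_cone_at_apex:
  fixes A :: "real^'n^'n"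
  assumes tile: "self_affine_tile A D T" and corner: "has_polyhedral_corner T"
  obtains y b E j P where "y \<in> T" "finite E" "\<And>e. e \<in> E \<Longrightarrow> 0 < b \<bullet> e"
    "germ_at T y (convex_cone hull E)" "\<And>x. x \<in> T \<Longrightarrow> x - y \<in> convex_cone hull E"
    "j \<ge> 1" "((*v) A ^^ j) ` (convex_cone hull E) = convex_cone hull E"
    "finite P" "frontier T \<subseteq> (\<Union>p\<in>P. (+) p ` frontier (convex_cone hull E))"
proof -
  have sa: "self_affine_set A D T" using tile by (auto simp: self_affine_tile_def)
  note inv = image_eq_of_self_affine(1)[OF sa]
  note reg = self_affine_tile_regular_closed[OF tile]
  let ?f = "\<lambda>k. (*v) A ^^ k" and ?g = "\<lambda>k. (*v) (matrix_inv A) ^^ k"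
  have lf: "linear (?f k)" and lg: "linear (?g k)" for k by (intro linear_funpow; simp)+
  obtain x0 r C where x0: "x0 \<in> T" "r > 0" "convex_polyhedral_cone C"
    "ball x0 r \<inter> T = (\<lambda>x. x0 + x) ` (ball 0 r \<inter> C)"
    using corner unfolding has_polyhedral_corner_def by blast
  obtain E b where E: "finite E" "\<And>e. e \<in> E \<Longrightarrow> 0 < b \<bullet> e" "C = convex_cone hull E"
    using convex_polyhedral_coneE[OF x0(3)] by blast
  have "germ_at T x0 C"
    unfolding germ_at_def
  proof (intro exI[of _ r] conjI allI impI)
    fix z :: "real^'n" assume z: "norm z < r"
    then have "x0 + z \<in> T \<longleftrightarrow> x0 + z \<in> ball x0 r \<inter> T" by (simp add: dist_norm)
    also have "\<dots> \<longleftrightarrow> z \<in> C" unfolding x0(4) using z by auto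
    finally show "x0 + z \<in> T \<longleftrightarrow> z \<in> C" .
  qed (rule x0(2))
  from tiled_patch_at_corner[OF tile this E(3,1,2)] obtain N where N: "\<And>k. k \<ge> N \<Longrightarrow>
      \<exists>y b' P. y \<in> T \<and> (\<forall>x\<in>T. x - y \<in> ?f k ` C) \<and>
      pointed_by b' (?f k ` C) \<and> germ_at T y (?f k ` C) \<and>
      finite P \<and> frontier T \<subseteq> (\<Union>p\<in>P. (+) p ` frontier (?f k ` C))"
    unfolding eventually_sequentially by blast
  have hull: "?f k ` C = convex_cone hull (?f k ` E)" for k
    unfolding E(3) by (rule convex_cone_hull_linear_image[OF lf, symmetric])
  obtain P0 where P0: "finite P0" "frontier T \<subseteq> (\<Union>p\<in>P0. (+) p ` frontier (?f N ` C))"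
    using N[of N] by blast
  have "hyperplane_coverable (\<Union>p\<in>P0. (+) p ` frontier (?f N ` C))"
    unfolding hull using P0(1) E(1)
    by (intro hyperplane_coverable_UN hyperplane_coverable_translation
        hyperplane_coverable_frontier_polyhedron polyhedron_convex_cone_hull) auto
  then have cov: "hyperplane_coverable (frontier T)" using P0(2) hyperplane_coverable_mono by blast
  let ?Y = "{y \<in> T. \<exists>b. \<forall>x\<in>T. x \<noteq> y \<longrightarrow> b \<bullet> y < b \<bullet> x}"
  have finY: "finite ?Y" by (rule finite_strict_minimizers[OF reg cov])
  have "\<exists>y\<in>?Y. (\<forall>x\<in>T. x - y \<in> ?f k ` C) \<and> germ_at T y (?f k ` C)" if k: "k \<ge> N" for k
  proof -
    obtain y b' where y: "y \<in> T" "\<forall>x\<in>T. x - y \<in> ?f k ` C"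
      "pointed_by b' (?f k ` C)" "germ_at T y (?f k ` C)" using N[OF k] by blast
    have "b' \<bullet> y < b' \<bullet> x" if "x \<in> T" "x \<noteq> y" for x
    proof -
      have "0 < b' \<bullet> (x - y)" 
        using y(2) y(3)[unfolded pointed_by_def, rule_format, of "x - y"] that by simp
      then show ?thesis by (simp add: inner_diff_right)
    qed
    then show ?thesis using y by blast
  qed
  then have "\<forall>k\<in>{N..}. \<exists>y. y \<in> ?Y \<and> (\<forall>x\<in>T. x - y \<in> ?f k ` C) \<and> germ_at T y (?f k ` C)"
    by auto
  from bchoice[OF this] obtain y where
    y: "\<And>k. k \<ge> N \<Longrightarrow> y k \<in> ?Y \<and> (\<forall>x\<in>T. x - y k \<in> ?f k ` C) \<and> germ_at T (y k) (?f k ` C)"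
    by auto
  have "\<not> inj_on y {N..}"
  proof
    assume "inj_on y {N..}"
    moreover have "y ` {N..} \<subseteq> ?Y" using y by auto
    then have "finite (y ` {N..})" using finY by (rule finite_subset)
    ultimately have "finite {N..}" using finite_imageD by blast
    then show False by (simp add: infinite_Ici)
  qed
  then obtain k l where kl: "N \<le> k" "k < l" "y k = y l"
    using linorder_inj_onI'[of "{N..}" y] by auto
  have con: "conic (?f k ` C)" for k unfolding hull by (rule conic_convex_cone_hull)
  have eq: "?f k ` C = ?f l ` C"
    by (rule conic_eq_if_common_germ[OF con con, of T "y k"])
      (use y[of k] y[of l] kl in auto)
  have "?f (l - k) ` (?f k ` C) = ?f (l - k + k) ` C" unfolding funpow_add image_comp ..
  then have invK: "?f (l - k) ` (?f k ` C) = ?f k ` C" using kl eq by simp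
  obtain y' P b' where P: "finite P" "frontier T \<subseteq> (\<Union>p\<in>P. (+) p ` frontier (?f k ` C))"
    "pointed_by b' (?f k ` C)"
    using N[OF kl(1)] by blast
  have "0 < b' \<bullet> e" if eE: "e \<in> ?f k ` E" for e
  proof -
    have "e \<in> ?f k ` C" unfolding hull using eE by (rule hull_inc)
    moreover have "e \<noteq> 0"
    proof
      assume "e = 0"
      then obtain e' where e': "e' \<in> E" "?f k e' = 0" using eE by auto
      then have "?g k (?f k e') = 0" by (simp add: linear_0[OF lg])
      then have "e' = 0" by (simp add: funpow_matrix_inv[OF inv])
      then show False using E(2)[OF e'(1)] by simp
    qed
    ultimately show ?thesis using P(3) unfolding pointed_by_def by blast
  qed
  then show ?thesis
    using that[of "y k" "?f k ` E" b' "l - k" P] y[OF kl(1)] E(1) kl(2) invK P(1,2)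
    unfolding hull by auto
qed

text \<open>
With \<open>A\<^sup>j K = K\<close> and \<open>T' = T - y\<close>, the sets \<open>A\<^bsup>jl\<^esup> T'\<close> are patches of the same cone \<open>K\<close>. The tile at the apex is
present at every stage, so \<open>T' \<subseteq> A\<^sup>j T'\<close>; the patches increase and exhaust \<open>K\<close>.
\<close>

lemma cone_tiling_of_invariant_cone:
  fixes A :: "real^'n^'n"
  assumes tile: "self_affine_tile A D T" and K: "K = convex_cone hull E" "finite E"
    "\<And>e. e \<in> E \<Longrightarrow> 0 < b \<bullet> e"
    and y: "y \<in> T" "germ_at T y K" "\<And>x. x \<in> T \<Longrightarrow> x - y \<in> K"
    and j: "j \<ge> 1" "((*v) A ^^ j) ` K = K"
  obtains J where "(\<Union>t\<in>J. (+) (t - y) ` T) = K"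
    "\<And>s t. s \<in> J \<Longrightarrow> t \<in> J \<Longrightarrow> s \<noteq> t \<Longrightarrow> negligible ((+) (s - y) ` T \<inter> (+) (t - y) ` T)"
proof -
  have sa: "self_affine_set A D T" and ex: "expanding A"
    using tile by (auto simp: self_affine_tile_def self_affine_set_def)
  note inv = image_eq_of_self_affine(1)[OF sa]
  let ?f = "\<lambda>k. (*v) A ^^ k" and ?g = "\<lambda>k. (*v) (matrix_inv A) ^^ k"
  have lf: "linear (?f k)" and lg: "linear (?g k)" for k by (intro linear_funpow; simp)+
  have pK: "pointed_by b K" unfolding K(1) by (rule pointed_by_convex_cone_hull[OF K(2,3)])
  define J where "J l = (\<lambda>d. d + y - ?f (j * l) y) ` digit_sums A D (j * l)" for l
  have level: "(\<Union>t\<in>J l. (+) (t - y) ` T) = (\<lambda>x. ?f (j * l) (x - y)) ` T" for l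
  proof -
    have "(\<lambda>x. ?f (j * l) (x - y)) ` T = (\<lambda>z. z - ?f (j * l) y) ` (?f (j * l) ` T)"
      by (simp add: image_image linear_diff[OF lf])
    also have "\<dots> = (\<Union>t\<in>J l. (+) (t - y) ` T)"
      unfolding funpow_image_self_affine[OF sa] J_def by (simp add: image_UN image_image algebra_simps)
    finally show ?thesis ..
  qed
  have fK: "?f (j * l) ` K = K" for l
  proof (induction l)
    case (Suc l)
    have "?f (j * Suc l) ` K = ?f j ` (?f (j * l) ` K)" by (simp add: funpow_add image_comp)
    then show ?case using Suc j(2) by simp
  qed simp
  have sub: "(\<Union>t\<in>J l. (+) (t - y) ` T) \<subseteq> K" for l
  proof -
    have "(\<lambda>x. ?f (j * l) (x - y)) ` T \<subseteq> ?f (j * l) ` K" using y(3) by auto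
    then show ?thesis unfolding level fK .
  qed
  \<comment> \<open>This says \<open>0 \<in> J 1\<close>: only a tile with translation vector \<open>0\<close> can contain the apex.\<close>
  have zero: "?f j y - y \<in> digit_sums A D j"
  proof -
    have "0 \<in> (\<lambda>x. ?f (j * 1) (x - y)) ` T" using y(1) linear_0[OF lf] by (auto intro!: image_eqI[of _ _ y])
    then obtain t s where ts: "t \<in> J 1" "s \<in> T" "0 = (t - y) + s" unfolding level[symmetric] by auto
    have "t \<in> (+) (t - y) ` T" using y(1) by force
    then have "t \<in> K" using sub[of 1] ts(1) by blast
    moreover have "s - y \<in> K" using y(3) ts(2) .
    moreover have "t + (s - y) = 0" using ts(3) by (simp add: algebra_simps)
    ultimately have "t = 0" using pointed_by_sum_zero[OF pK] by blast
    then obtain d where "d \<in> digit_sums A D j" "d + y - ?f j y = 0" using ts(1) by (auto simp: J_def)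
    then show ?thesis by (metis add_diff_cancel diff_add_cancel eq_iff_diff_eq_0)
  qed
  have mono1: "J l \<subseteq> J (Suc l)" for l
  proof
    fix t assume "t \<in> J l"
    then obtain d where d: "d \<in> digit_sums A D (j * l)" "t = d + y - ?f (j * l) y" by (auto simp: J_def)
    have "d + ?f (j * l) (?f j y - y) \<in> digit_sums A D (j * l + j)" by (rule digit_sums_add[OF d(1) zero])
    moreover have "?f (j * l) (?f j y - y) = ?f (j * l + j) y - ?f (j * l) y"
      by (simp add: linear_diff[OF lf] funpow_add)
    ultimately have "d + (?f (j * Suc l) y - ?f (j * l) y) \<in> digit_sums A D (j * Suc l)"
      by (simp add: add.commute)
    moreover have "t = (d + (?f (j * Suc l) y - ?f (j * l) y)) + y - ?f (j * Suc l) y" using d(2) by simp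
    ultimately show "t \<in> J (Suc l)" unfolding J_def by (rule image_eqI[rotated])
  qed
  have mono: "J l \<subseteq> J m" if "l \<le> m" for l m using that by (rule lift_Suc_mono_le[of J, OF mono1])
  show ?thesis
  proof (rule that[of "\<Union>l. J l"])
    show "(\<Union>t\<in>(\<Union>l. J l). (+) (t - y) ` T) = K"
    proof
      show "(\<Union>t\<in>(\<Union>l. J l). (+) (t - y) ` T) \<subseteq> K" using sub by blast
      show "K \<subseteq> (\<Union>t\<in>(\<Union>l. J l). (+) (t - y) ` T)"
      proof
        fix z assume z: "z \<in> K"
        obtain \<rho> where \<rho>: "\<rho> > 0" "\<And>z. norm z < \<rho> \<Longrightarrow> y + z \<in> T \<longleftrightarrow> z \<in> K"
          using y(2) unfolding germ_at_def by blast
        have "0 < \<rho> / (norm z + 1)" using \<rho>(1) by (intro divide_pos_pos) (auto intro: add_nonneg_pos)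
        from expanding_inverse_contracts[OF ex inv this]
        obtain N where N: "\<And>k x. k \<ge> N \<Longrightarrow> norm (?g k x) \<le> \<rho> / (norm z + 1) * norm x"
          unfolding eventually_sequentially by blast
        have "N \<le> j * N" using j(1) by simp
        from N[OF this, of z] have "norm (?g (j * N) z) \<le> \<rho> * (norm z / (norm z + 1))" by simp
        also have "\<dots> < \<rho> * 1" using \<rho>(1)
          by (intro mult_strict_left_mono) (auto simp: divide_less_eq add_nonneg_pos)
        finally have small: "norm (?g (j * N) z) < \<rho>" by simp
        have "?g (j * N) z \<in> K"
        proof -
          have "z \<in> ?f (j * N) ` K" using z fK by simp
          then show ?thesis by (auto simp: funpow_matrix_inv[OF inv])
        qed
        then have "y + ?g (j * N) z \<in> T" using \<rho>(2)[OF small] by simp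
        then have "?f (j * N) ((y + ?g (j * N) z) - y) \<in> (\<lambda>x. ?f (j * N) (x - y)) ` T" by (rule imageI)
        then have "z \<in> (\<Union>t\<in>J N. (+) (t - y) ` T)" unfolding level by (simp add: funpow_matrix_inv[OF inv])
        then show "z \<in> (\<Union>t\<in>(\<Union>l. J l). (+) (t - y) ` T)" by blast
      qed
    qed
    show "negligible ((+) (s - y) ` T \<inter> (+) (t - y) ` T)"
      if st: "s \<in> (\<Union>l. J l)" "t \<in> (\<Union>l. J l)" "s \<noteq> t" for s t
    proof -
      obtain l m where "s \<in> J l" "t \<in> J m" using st by blast
      then have "s \<in> J (max l m)" "t \<in> J (max l m)" using mono[of l "max l m"] mono[of m "max l m"] by auto
      then obtain d e where de: "d \<in> digit_sums A D (j * max l m)" "e \<in> digit_sums A D (j * max l m)"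
        "s = d + y - ?f (j * max l m) y" "t = e + y - ?f (j * max l m) y" by (auto simp: J_def)
      let ?c = "- ?f (j * max l m) y"
      have eq: "(+) (s - y) ` T = (+) ?c ` ((+) d ` T)" "(+) (t - y) ` T = (+) ?c ` ((+) e ` T)"
        unfolding de(3,4) image_image by (auto intro!: image_cong)
      have "d \<noteq> e" using st(3) de by auto
      with de(1,2) have "negligible ((+) d ` T \<inter> (+) e ` T)" by (rule negligible_overlap_digit_sums[OF sa])
      then have "negligible ((+) ?c ` ((+) d ` T \<inter> (+) e ` T))" by (rule negligible_translation)
      moreover have "(+) ?c ` ((+) d ` T \<inter> (+) e ` T) = (+) (s - y) ` T \<inter> (+) (t - y) ` T"
        unfolding eq by (rule image_Int) simp
      ultimately show ?thesis by simp
    qed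
  qed
qed

section \<open>Cones tiled by translates are simplicial\<close>

text \<open>
A generator that the other generators do not produce spans an extreme ray: the coefficients at the
other generators in \<open>u + v\<close> produce a multiple of \<open>e\<close>, which is not positive by irredundancy and not
negative by pointedness. So it is \<open>0\<close>, and these coefficients vanish.
\<close>

lemma extreme_ray_summand:
  fixes E :: "'a::euclidean_space set"
  assumes E: "finite E" "\<And>e. e \<in> E \<Longrightarrow> 0 < b \<bullet> e"
    and irr: "e \<in> E" "e \<notin> convex_cone hull (E - {e})"
    and uv: "u \<in> convex_cone hull E" "v \<in> convex_cone hull E" "u + v = s *\<^sub>R e"
  obtains c where "0 \<le> c" "v = c *\<^sub>R e"
proof -
  note ex = convex_cone_hull_indexed[OF E(1), of "\<lambda>e. e", unfolded image_ident]
  obtain \<mu> where \<mu>: "u = (\<Sum>f\<in>E. \<mu> f *\<^sub>R f)" "\<forall>f\<in>E. 0 \<le> \<mu> f" using uv(1) unfolding ex by blast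
  obtain \<nu> where \<nu>: "v = (\<Sum>f\<in>E. \<nu> f *\<^sub>R f)" "\<forall>f\<in>E. 0 \<le> \<nu> f" using uv(2) unfolding ex by blast
  define w where "w = \<mu> e + \<nu> e"
  let ?S = "\<Sum>f\<in>E - {e}. (\<mu> f + \<nu> f) *\<^sub>R f"
  have "u + v = (\<Sum>f\<in>E. (\<mu> f + \<nu> f) *\<^sub>R f)"
    by (simp add: \<mu>(1) \<nu>(1) scaleR_add_left sum.distrib)
  also have "\<dots> = w *\<^sub>R e + ?S" by (simp add: sum.remove[OF E(1) irr(1)] w_def)
  finally have S: "?S = (s - w) *\<^sub>R e" using uv(3) by (simp add: algebra_simps)
  have le: "s \<le> w"
  proof (rule ccontr)
    assume "\<not> s \<le> w"
    then have sw: "s - w > 0" by simp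
    have "?S \<in> convex_cone hull (E - {e})"
      using \<mu>(2) \<nu>(2) E(1) convex_cone_hull_indexed[of "E - {e}" "\<lambda>e. e"] by auto
    then have "(1 / (s - w)) *\<^sub>R ?S \<in> convex_cone hull (E - {e})"
      by (rule convex_cone_hull_mul) (use sw in simp)
    then show False using irr(2) sw unfolding S by simp
  qed
  have "b \<bullet> ?S = (\<Sum>f\<in>E - {e}. (\<mu> f + \<nu> f) * (b \<bullet> f))" by (simp add: inner_sum_right)
  moreover have "b \<bullet> ?S \<le> 0" unfolding S using le E(2)[OF irr(1)] by (simp add: mult_nonpos_nonneg)
  moreover have nn: "\<And>f. f \<in> E - {e} \<Longrightarrow> 0 \<le> (\<mu> f + \<nu> f) * (b \<bullet> f)"
    using \<mu>(2) \<nu>(2) E(2) by (simp add: less_imp_le)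
  ultimately have "(\<Sum>f\<in>E - {e}. (\<mu> f + \<nu> f) * (b \<bullet> f)) = 0"
    by (intro antisym sum_nonneg) auto
  then have zero: "\<forall>f\<in>E - {e}. (\<mu> f + \<nu> f) * (b \<bullet> f) = 0"
    using sum_nonneg_eq_0_iff[of "E - {e}" "\<lambda>f. (\<mu> f + \<nu> f) * (b \<bullet> f)"] nn E(1) by simp
  have "\<nu> f = 0" if "f \<in> E - {e}" for f
  proof -
    have "\<mu> f + \<nu> f = 0" using zero that E(2)[of f] by auto
    then show ?thesis using \<mu>(2) \<nu>(2) that by (simp add: add_nonneg_eq_0_iff)
  qed
  then have "v = \<nu> e *\<^sub>R e" by (simp add: \<nu>(1) sum.remove[OF E(1) irr(1)])
  then show ?thesis using that \<nu>(2) irr(1) by blast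
qed

text \<open>
A ball inside \<open>T\<close> gives disjoint balls in all translates.
\<close>

lemma uniform_discrete_translates:
  fixes T :: "'a::euclidean_space set"
  assumes int: "interior T \<noteq> {}"
    and disj: "\<And>s t. s \<in> J \<Longrightarrow> t \<in> J \<Longrightarrow> s \<noteq> t \<Longrightarrow> interior ((+) s ` T) \<inter> interior ((+) t ` T) = {}"
  shows "uniform_discrete J"
proof -
  obtain c where "c \<in> interior T" using int by blast
  then obtain r where r: "0 < r" "ball c r \<subseteq> interior T" by (meson open_contains_ball open_interior)
  show ?thesis
  proof (rule uniformI1[OF r(1)], rule ccontr)
    fix s t assume st: "s \<in> J" "t \<in> J" "dist s t < r" "s \<noteq> t"
    have "c \<in> interior T" using r by (meson centre_in_ball subsetD)
    then have "s + c \<in> interior ((+) s ` T)" unfolding interior_translation by (rule imageI)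
    moreover have "s + c - t \<in> ball c r" using st(3) by (simp add: dist_norm algebra_simps norm_minus_commute)
    then have "t + (s + c - t) \<in> interior ((+) t ` T)" unfolding interior_translation using r(2) by blast
    ultimately show False using disj[OF st(1,2,4)] by auto
  qed
qed

text \<open>
A tiling of a pointed cone by translates of \<open>T\<close>, with \<open>T\<close> positioned so that its apex is \<open>0\<close>. The
generators in \<open>E\<close> are irredundant, hence represent the extreme rays.
\<close>

locale cone_tiling =
  fixes E T J :: "'a::euclidean_space set" and b :: 'a and K :: "'a set"
  assumes finite_E: "finite E" and b_pos: "\<And>e. e \<in> E \<Longrightarrow> 0 < b \<bullet> e"
    and irredundant: "\<And>e. e \<in> E \<Longrightarrow> e \<notin> convex_cone hull (E - {e})"
    and K_def: "K = convex_cone hull E"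
    and compact_T: "compact T" and zero_T: "0 \<in> T" and T_subset_K: "T \<subseteq> K" and interior_T: "interior T \<noteq> {}"
    and tiling: "(\<Union>t\<in>J. (+) t ` T) = K"
    and disjoint_interiors: "\<And>s t. s \<in> J \<Longrightarrow> t \<in> J \<Longrightarrow> s \<noteq> t \<Longrightarrow>
      interior ((+) s ` T) \<inter> interior ((+) t ` T) = {}"
begin

lemma pointed_K: "pointed_by b K"
  unfolding K_def by (rule pointed_by_convex_cone_hull[OF finite_E b_pos])

lemma closed_K: "closed K"
  unfolding K_def by (rule closed_convex_cone_hull[OF finite_E])

lemma E_subset_K: "E \<subseteq> K"
  unfolding K_def by (rule hull_subset)

lemma K_add: "x \<in> K \<Longrightarrow> y \<in> K \<Longrightarrow> x + y \<in> K"
  unfolding K_def by (rule convex_cone_hull_add)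

lemma K_scale: "x \<in> K \<Longrightarrow> 0 \<le> c \<Longrightarrow> c *\<^sub>R x \<in> K"
  unfolding K_def by (rule convex_cone_hull_mul)

lemma zero_K: "0 \<in> K"
  unfolding K_def by (rule convex_cone_hull_contains_0)

lemma K_sum: "(\<And>f. f \<in> I \<Longrightarrow> 0 \<le> c f \<and> f \<in> K) \<Longrightarrow> (\<Sum>f\<in>I. c f *\<^sub>R f) \<in> K"
  by (induction I rule: infinite_finite_induct)
    (auto intro!: K_add K_scale zero_K)

lemma J_subset_K: "t \<in> J \<Longrightarrow> t \<in> K"
  using tiling zero_T by force

lemma finite_bounded_J: "finite {t\<in>J. norm t \<le> B}"
proof -
  have "uniform_discrete J" by (rule uniform_discrete_translates[OF interior_T disjoint_interiors])
  then have "uniform_discrete {t\<in>J. norm t \<le> B}" by (rule uniform_discrete_subset) auto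
  moreover have "bounded {t\<in>J. norm t \<le> B}" by (auto simp: bounded_iff)
  ultimately show ?thesis using uniform_discrete_finite_iff by blast
qed

lemma extreme_ray_point_cover:
  assumes e: "e \<in> E" and x: "x \<in> T" and t: "t \<in> J" and eq: "s *\<^sub>R e = t + x"
  obtains c where "0 \<le> c" "t = c *\<^sub>R e"
proof -
  have "x + t = s *\<^sub>R e" using eq by simp
  then show ?thesis
    using extreme_ray_summand[OF finite_E b_pos e irredundant[OF e], of x t s] T_subset_K x J_subset_K[OF t] that
    unfolding K_def by blast
qed

text \<open>
The bounded set \<open>T\<close> leaves part of an extreme ray uncovered, and a tile that meets an extreme ray has
its translation vector on that ray. Local finiteness provides a first such vector \<open>\<tau> e\<close>.
\<close>

lemma ex_first_tile_on_ray:
  assumes e: "e \<in> E"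
  obtains \<tau> where "0 < \<tau>" "\<tau> *\<^sub>R e \<in> J" "\<And>c. 0 < c \<Longrightarrow> c *\<^sub>R e \<in> J \<Longrightarrow> \<tau> \<le> c"
proof -
  have ne: "0 < norm e" using b_pos[OF e] by auto
  obtain M where M: "0 < M" "\<And>x. x \<in> T \<Longrightarrow> norm x \<le> M"
    using compact_imp_bounded[OF compact_T] by (auto simp: bounded_pos)
  define s where "s = (M + 1) / norm e"
  have s: "0 < s" "norm (s *\<^sub>R e) = M + 1" using ne M(1) by (auto simp: s_def)
  have "s *\<^sub>R e \<in> K" using E_subset_K e s(1) by (auto intro: K_scale)
  then obtain t x where t: "t \<in> J" "x \<in> T" "s *\<^sub>R e = t + x" unfolding tiling[symmetric] by auto
  obtain c where c: "0 \<le> c" "t = c *\<^sub>R e" using extreme_ray_point_cover[OF e t(2,1,3)] .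
  have "c \<noteq> 0" using t(3) c(2) s(2) M(2)[OF t(2)] by auto
  define C where "C = {c'. 0 < c' \<and> c' \<le> c \<and> c' *\<^sub>R e \<in> J}"
  have "c \<in> C" using c t(1) \<open>c \<noteq> 0\<close> by (simp add: C_def)
  have "finite C"
  proof (rule finite_imageD)
    show "inj_on (\<lambda>c. c *\<^sub>R e) C" using ne by (auto intro: inj_onI)
    show "finite ((\<lambda>c. c *\<^sub>R e) ` C)"
      by (rule finite_subset[OF _ finite_bounded_J[of "c * norm e"]])
        (auto simp: C_def mult_right_mono)
  qed
  show ?thesis
  proof (rule that[of "Min C"])
    have "Min C \<in> C" using \<open>finite C\<close> \<open>c \<in> C\<close> by (intro Min_in) auto
    then show "0 < Min C" "Min C *\<^sub>R e \<in> J" by (auto simp: C_def)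
    show "Min C \<le> c'" if "0 < c'" "c' *\<^sub>R e \<in> J" for c'
    proof (cases "c' \<le> c")
      case True
      then show ?thesis using \<open>finite C\<close> that by (intro Min_le) (auto simp: C_def)
    next
      case False
      then show ?thesis using Min_le[OF \<open>finite C\<close> \<open>c \<in> C\<close>] by simp
    qed
  qed
qed

text \<open>
A tile through the point \<open>\<tau> e\<close> is \<open>T\<close> or \<open>\<tau> e + T\<close>. The points \<open>\<tau> e + \<sigma> q\<close> with
\<open>q = k - s e + u\<close> and small \<open>\<sigma>\<close> are in \<open>K\<close>, but not in \<open>\<tau> e + K\<close> when \<open>q \<notin> K\<close>, so \<open>T\<close> itself has to cover
them. In other words, near \<open>\<tau> e\<close> the tile \<open>T\<close> contains \<open>(K + \<real> e) - K\<close>.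
\<close>

lemma tile_near_first_ray_tile:
  assumes e: "e \<in> E" and \<tau>: "0 < \<tau>" "\<And>c. 0 < c \<Longrightarrow> c *\<^sub>R e \<in> J \<Longrightarrow> \<tau> \<le> c"
    and k: "k \<in> K" "0 \<le> s" and U: "U \<subseteq> K" "bounded U" "\<And>u. u \<in> U \<Longrightarrow> k - s *\<^sub>R e + u \<notin> K"
  obtains \<sigma>\<^sub>0 where "0 < \<sigma>\<^sub>0"
    "\<And>\<sigma> u. 0 < \<sigma> \<Longrightarrow> \<sigma> < \<sigma>\<^sub>0 \<Longrightarrow> u \<in> U \<Longrightarrow> \<tau> *\<^sub>R e + \<sigma> *\<^sub>R (k - s *\<^sub>R e + u) \<in> T"
proof -
  obtain M where M: "0 < M" "\<And>x. x \<in> T \<Longrightarrow> norm x \<le> M"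
    using compact_imp_bounded[OF compact_T] by (auto simp: bounded_pos)
  obtain BU where BU: "\<And>u. u \<in> U \<Longrightarrow> norm u \<le> BU" using U(2) by (auto simp: bounded_iff)
  define B where "B = norm (k - s *\<^sub>R e) + \<bar>BU\<bar> + 1"
  have B: "0 < B" "\<And>u. u \<in> U \<Longrightarrow> norm (k - s *\<^sub>R e + u) < B"
  proof -
    show "0 < B" unfolding B_def by (intro add_nonneg_pos) auto
    show "norm (k - s *\<^sub>R e + u) < B" if "u \<in> U" for u
      using BU[OF that] norm_triangle_ineq[of "k - s *\<^sub>R e" u] unfolding B_def by linarith
  qed
  \<comment> \<open>Bounds the translation vectors of all tiles that come within distance \<open>1\<close> of \<open>\<tau> e\<close>.\<close>
  define N where "N = M + norm (\<tau> *\<^sub>R e) + 1"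
  let ?L = "{t \<in> {t\<in>J. norm t \<le> N}. \<tau> *\<^sub>R e \<notin> (+) t ` T}"
  let ?O = "\<Union>t\<in>?L. (+) t ` T"
  have "finite ?L" by (rule finite_subset[OF _ finite_bounded_J[of N]]) auto
  then have "closed ?O"
    by (rule closed_UN) (intro ballI closed_translation compact_imp_closed[OF compact_T])
  then have "open (- ?O)" by (rule open_Compl)
  moreover have "\<tau> *\<^sub>R e \<in> - ?O" by simp
  ultimately obtain \<eta>' where \<eta>': "0 < \<eta>'" "ball (\<tau> *\<^sub>R e) \<eta>' \<subseteq> - ?O"
    by (meson open_contains_ball)
  define \<eta> where "\<eta> = min \<eta>' 1"
  have \<eta>: "0 < \<eta>" "\<eta> \<le> 1" "\<eta> \<le> \<eta>'" using \<eta>'(1) by (auto simp: \<eta>_def)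
  show ?thesis
  proof (rule that[of "min (\<eta> / B) (\<tau> / (s + 1))"])
    \<comment> \<open>The first bound keeps \<open>\<sigma> q\<close> within \<open>\<eta>\<close>, the second keeps the coefficient \<open>\<tau> - \<sigma> s\<close> of \<open>e\<close> nonnegative.\<close>
    show "0 < min (\<eta> / B) (\<tau> / (s + 1))" using \<eta> B \<tau> k(2) by simp
    fix \<sigma> u assume \<sigma>: "0 < \<sigma>" "\<sigma> < min (\<eta> / B) (\<tau> / (s + 1))" and u: "u \<in> U"
    let ?q = "k - s *\<^sub>R e + u"
    let ?p = "\<tau> *\<^sub>R e + \<sigma> *\<^sub>R ?q"
    have "\<sigma> * s \<le> \<sigma> * (s + 1)" using \<sigma>(1) by simp
    also have "\<dots> < \<tau>" using \<sigma>(2) k(2) by (simp add: pos_less_divide_eq)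
    finally have "0 \<le> \<tau> - \<sigma> * s" by simp
    moreover have "?p = \<sigma> *\<^sub>R (k + u) + (\<tau> - \<sigma> * s) *\<^sub>R e" by (simp add: algebra_simps)
    ultimately have "?p \<in> K" using k(1) U(1) u E_subset_K e \<sigma>(1)
      by (auto intro!: K_add K_scale simp del: scaleR_right_diff_distrib)
    then obtain t x where t: "t \<in> J" "x \<in> T" "?p = t + x" unfolding tiling[symmetric] by auto
    have "norm (\<sigma> *\<^sub>R ?q) < \<eta>"
    proof -
      have "\<sigma> * norm ?q \<le> \<sigma> * B" using B(2)[OF u] \<sigma>(1) by simp
      also have "\<dots> < \<eta>" using \<sigma>(2) B(1) by (simp add: pos_less_divide_eq)
      finally show ?thesis using \<sigma>(1) by simp
    qed
    then have pO: "?p \<notin> ?O" "norm (\<sigma> *\<^sub>R ?q) \<le> 1"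
      using \<eta>'(2) \<eta> by (auto simp: subset_iff dist_norm)
    have "t = \<tau> *\<^sub>R e + \<sigma> *\<^sub>R ?q - x" using t(3) by (simp add: algebra_simps)
    then have "norm t \<le> norm (\<tau> *\<^sub>R e) + norm (\<sigma> *\<^sub>R ?q) + norm x"
      using norm_triangle_ineq[of "\<tau> *\<^sub>R e" "\<sigma> *\<^sub>R ?q"] norm_triangle_ineq4[of "\<tau> *\<^sub>R e + \<sigma> *\<^sub>R ?q" x] by simp
    then have "norm t \<le> N" using pO(2) M(2)[OF t(2)] by (simp add: N_def)
    moreover have "?p \<in> (+) t ` T" using t by blast
    ultimately have "\<tau> *\<^sub>R e \<in> (+) t ` T" using pO(1) t(1) by blast
    then obtain x' where x': "x' \<in> T" "\<tau> *\<^sub>R e = t + x'" by blast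
    obtain c where c: "0 \<le> c" "t = c *\<^sub>R e" using extreme_ray_point_cover[OF e x'(1) t(1) x'(2)] .
    show "?p \<in> T"
    proof (cases "c = 0")
      case True
      then show ?thesis using t c by simp
    next
      case False
      then have "\<tau> \<le> c" using \<tau>(2) c t(1) by simp
      moreover have "c \<le> \<tau>"
      proof -
        have "0 \<le> b \<bullet> x'" using x'(1) T_subset_K pointed_by_nonneg[OF pointed_K] by blast
        moreover have "x' = (\<tau> - c) *\<^sub>R e" using x'(2) c(2) by (simp add: algebra_simps)
        ultimately have "0 \<le> (\<tau> - c) * (b \<bullet> e)" by simp
        then show ?thesis using b_pos[OF e] by (simp add: zero_le_mult_iff)
      qed
      ultimately have "x = \<sigma> *\<^sub>R ?q" using t(3) c(2) by simp
      then have "(1 / \<sigma>) *\<^sub>R (\<sigma> *\<^sub>R ?q) \<in> K" using t(2) T_subset_K \<sigma>(1) by (intro K_scale[of "\<sigma> *\<^sub>R ?q"]) auto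
      then show ?thesis using U(3)[OF u] \<sigma>(1) by simp
    qed
  qed
qed

text \<open>
Let \<open>a\<close> and \<open>d\<close> be generators with first tiles at \<open>\<tau> a\<close> and \<open>\<tau>' d\<close>. By the preceding lemma, the tiles
\<open>\<tau> a + T\<close> and \<open>\<tau>' d + T\<close> contain, near \<open>\<tau> a + \<tau>' d\<close>, the translates of \<open>(K + \<real> d) - K\<close> and of \<open>(K + \<real> a) - K\<close>.
They would overlap if some \<open>z \<notin> K\<close> belonged to both \<open>K + \<real> d\<close> and \<open>K + \<real> a\<close>, for then \<open>z\<close> plus a small
open part of \<open>K\<close> does so too.

A linear relation \<open>\<Sum> c f *\<^sub>R f = 0\<close> between the generators provides such a \<open>z\<close>. Pick \<open>a\<close> with positive and
\<open>d\<close> with negative coefficient (both signs occur, as the cone is pointed), and let \<open>z\<close> be the positive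
part of the relation without its term at \<open>a\<close>, plus the negative term at \<open>d\<close>; by the relation this is
also the negated negative part without its term at \<open>d\<close>, minus the positive term at \<open>a\<close>. If the
relation has as few positive coefficients as possible, then \<open>z \<notin> K\<close>, because writing \<open>z\<close> as a
nonnegative combination would give a relation with fewer positive coefficients.
\<close>

theorem independent_generators:
  assumes intK: "interior K \<noteq> {}"
  shows "independent E"
proof
  assume "dependent E"
  define rel where "rel c \<longleftrightarrow> (\<Sum>f\<in>E. c f *\<^sub>R f) = 0 \<and> (\<exists>f\<in>E. c f \<noteq> 0)" for c :: "'a \<Rightarrow> real"
  have "\<exists>c. rel c" using \<open>dependent E\<close> by (auto simp: rel_def dependent_finite[OF finite_E])
  then obtain c where c: "rel c" and least: "\<And>c'. rel c' \<Longrightarrow> card {f\<in>E. 0 < c f} \<le> card {f\<in>E. 0 < c' f}"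
    using ex_has_least_nat[of rel _ "\<lambda>c. card {f\<in>E. 0 < c f}"] by blast
  define Pos where "Pos = {f\<in>E. 0 < c f}"
  define Neg where "Neg = {f\<in>E. c f < 0}"
  have fin: "finite Pos" "finite Neg" using finite_E by (auto simp: Pos_def Neg_def)
  have bsum: "(\<Sum>f\<in>E. c f * (b \<bullet> f)) = 0"
  proof -
    have "b \<bullet> (\<Sum>f\<in>E. c f *\<^sub>R f) = 0" using c by (simp add: rel_def)
    then show ?thesis by (simp add: inner_sum_right)
  qed
  have zeros: False if "\<forall>f\<in>E. 0 \<le> \<epsilon> * c f" "\<epsilon> \<noteq> 0" for \<epsilon> :: real
  proof -
    have "(\<Sum>f\<in>E. \<epsilon> * c f * (b \<bullet> f)) = \<epsilon> * (\<Sum>f\<in>E. c f * (b \<bullet> f))" by (simp add: sum_distrib_left mult.assoc)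
    then have "(\<Sum>f\<in>E. \<epsilon> * c f * (b \<bullet> f)) = 0" using bsum by simp
    moreover have "0 \<le> \<epsilon> * c f * (b \<bullet> f)" if "f \<in> E" for f
      using \<open>\<forall>f\<in>E. 0 \<le> \<epsilon> * c f\<close> b_pos[OF that] that by (simp add: less_imp_le)
    ultimately have "\<forall>f\<in>E. \<epsilon> * c f * (b \<bullet> f) = 0"
      by (subst (asm) sum_nonneg_eq_0_iff[OF finite_E]) auto
    then show False using c that(2) b_pos by (force simp: rel_def)
  qed
  have "Pos \<noteq> {}" using zeros[of "-1"] by (auto simp: Pos_def not_less)
  then obtain a where a: "a \<in> E" "0 < c a" by (auto simp: Pos_def)
  have "Neg \<noteq> {}" using zeros[of "1"] by (auto simp: Neg_def not_less)
  then obtain d where d: "d \<in> E" "c d < 0" by (auto simp: Neg_def)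
  define k1 where "k1 = (\<Sum>f\<in>Pos - {a}. c f *\<^sub>R f)"
  define k2 where "k2 = (\<Sum>f\<in>Neg - {d}. (- c f) *\<^sub>R f)"
  define z where "z = k1 - (- c d) *\<^sub>R d"
  have kK: "k1 \<in> K" "k2 \<in> K"
    unfolding k1_def k2_def
    by (rule K_sum; use E_subset_K in \<open>auto simp: Pos_def Neg_def\<close>)+
  have z2: "z = k2 - c a *\<^sub>R a"
  proof -
    have "(\<Sum>f\<in>E. c f *\<^sub>R f) = (\<Sum>f\<in>Pos \<union> Neg. c f *\<^sub>R f)"
      by (rule sum.mono_neutral_right) (use finite_E in \<open>auto simp: Pos_def Neg_def\<close>)
    also have "\<dots> = (\<Sum>f\<in>Pos. c f *\<^sub>R f) + (\<Sum>f\<in>Neg. c f *\<^sub>R f)"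
      using fin by (intro sum.union_disjoint) (auto simp: Pos_def Neg_def)
    also have "(\<Sum>f\<in>Pos. c f *\<^sub>R f) = c a *\<^sub>R a + k1"
      unfolding k1_def using fin a by (intro sum.remove) (auto simp: Pos_def)
    also have "(\<Sum>f\<in>Neg. c f *\<^sub>R f) = c d *\<^sub>R d + (\<Sum>f\<in>Neg - {d}. c f *\<^sub>R f)"
      using fin d by (intro sum.remove) (auto simp: Neg_def)
    also have "(\<Sum>f\<in>Neg - {d}. c f *\<^sub>R f) = - k2" by (simp add: k2_def sum_negf)
    finally have "c a *\<^sub>R a + k1 + (c d *\<^sub>R d - k2) = 0" using c by (simp add: rel_def)
    then show ?thesis by (simp add: z_def algebra_simps)
  qed
  have zK: "z \<notin> K"
  proof
    assume "z \<in> K"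
    then obtain l where l: "z = (\<Sum>f\<in>E. l f *\<^sub>R f)" "\<forall>f\<in>E. 0 \<le> l f"
      unfolding K_def convex_cone_hull_indexed[OF finite_E, of "\<lambda>e. e", unfolded image_ident] by blast
    \<comment> \<open>Positive coefficients can only remain at \<open>Pos - {a}\<close>, and the one at \<open>d\<close> stays negative.\<close>
    define c' where "c' f = (if f \<in> Pos - {a} then c f else 0) + (if f = d then c d else 0) - l f" for f
    have "(\<Sum>f\<in>E. c' f *\<^sub>R f) = (\<Sum>f\<in>E. if f \<in> Pos - {a} then c f *\<^sub>R f else 0)
        + (\<Sum>f\<in>E. if f = d then c d *\<^sub>R f else 0) - z"
      unfolding l(1) sum.distrib[symmetric] sum_subtractf[symmetric]
      by (rule sum.cong) (auto simp: c'_def algebra_simps)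
    also have "(\<Sum>f\<in>E. if f \<in> Pos - {a} then c f *\<^sub>R f else 0) = k1"
      unfolding k1_def using finite_E by (intro sum.mono_neutral_cong_right) (auto simp: Pos_def)
    also have "(\<Sum>f\<in>E. if f = d then c d *\<^sub>R f else 0) = c d *\<^sub>R d" using finite_E d(1) by simp
    finally have "(\<Sum>f\<in>E. c' f *\<^sub>R f) = 0" by (simp add: z_def)
    moreover have "d \<notin> Pos" using d by (simp add: Pos_def)
    then have "c' d < 0" using d l(2) by (auto simp: c'_def add_neg_nonpos)
    ultimately have "rel c'" using d(1) by (auto simp: rel_def intro!: bexI[of _ d])
    then have "card Pos \<le> card {f\<in>E. 0 < c' f}" using least by (simp add: Pos_def)
    also have "\<dots> \<le> card (Pos - {a})"
    proof (rule card_mono)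
      show "{f\<in>E. 0 < c' f} \<subseteq> Pos - {a}"
      proof clarify
        fix f assume f: "f \<in> E" "0 < c' f"
        then show "f \<in> Pos - {a}" using l(2)[rule_format, OF f(1)] d(2)
          by (auto simp: c'_def split: if_splits)
      qed
    qed (use fin in simp)
    also have "\<dots> < card Pos" using fin a by (intro card_Diff1_less) (auto simp: Pos_def)
    finally show False by simp
  qed
  obtain w0 \<rho> where w0: "0 < \<rho>" "ball w0 \<rho> \<subseteq> K" using intK by (meson all_not_in_conv mem_interior)
  have "open (- K)" using closed_K by (rule open_Compl)
  then obtain \<eta> where \<eta>: "0 < \<eta>" "ball z \<eta> \<subseteq> - K" using zK by (meson ComplI open_contains_ball)
  \<comment> \<open>Shrinks the ball around \<open>w0\<close> so far that adding its points to \<open>z\<close> does not lead back into \<open>K\<close>.\<close>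
  define \<epsilon> where "\<epsilon> = \<eta> / (norm w0 + \<rho>)"
  have \<epsilon>: "0 < \<epsilon>" using \<eta>(1) w0(1) by (simp add: \<epsilon>_def add_nonneg_pos)
  define U where "U = (*\<^sub>R) \<epsilon> ` ball w0 \<rho>"
  have U: "U \<subseteq> K" unfolding U_def using w0(2) \<epsilon> by (auto intro: K_scale)
  have Ub: "bounded U" unfolding U_def by (intro bounded_scaling) auto
  have Uz: "z + u \<notin> K" if u: "u \<in> U" for u
  proof -
    obtain w where w: "w \<in> ball w0 \<rho>" "u = \<epsilon> *\<^sub>R w" using u by (auto simp: U_def)
    have "norm w < norm w0 + \<rho>" using w(1) norm_triangle_ineq2[of w w0] by (simp add: dist_norm norm_minus_commute)
    then have "\<epsilon> * norm w < \<epsilon> * (norm w0 + \<rho>)" using \<epsilon> by simp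
    also have "\<dots> = \<eta>" using w0(1) norm_ge_zero[of w0] unfolding \<epsilon>_def by (metis add_nonneg_pos less_irrefl nonzero_eq_divide_eq)
    finally have "norm u < \<eta>" using w(2) \<epsilon> by simp
    then have "z + u \<in> ball z \<eta>" by (simp add: dist_norm)
    then show ?thesis using \<eta>(2) by blast
  qed
  obtain \<tau> where \<tau>: "0 < \<tau>" "\<tau> *\<^sub>R a \<in> J" "\<And>c. 0 < c \<Longrightarrow> c *\<^sub>R a \<in> J \<Longrightarrow> \<tau> \<le> c"
    using ex_first_tile_on_ray[OF a(1)] by blast
  obtain \<tau>' where \<tau>': "0 < \<tau>'" "\<tau>' *\<^sub>R d \<in> J" "\<And>c. 0 < c \<Longrightarrow> c *\<^sub>R d \<in> J \<Longrightarrow> \<tau>' \<le> c"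
    using ex_first_tile_on_ray[OF d(1)] by blast
  obtain \<sigma>1 where \<sigma>1: "0 < \<sigma>1" "\<And>\<sigma> u. 0 < \<sigma> \<Longrightarrow> \<sigma> < \<sigma>1 \<Longrightarrow> u \<in> U \<Longrightarrow> \<tau>' *\<^sub>R d + \<sigma> *\<^sub>R (z + u) \<in> T"
    using tile_near_first_ray_tile[OF d(1) \<tau>'(1,3) kK(1), of "- c d" U] d(2) U Ub Uz unfolding z_def by auto
  obtain \<sigma>2 where \<sigma>2: "0 < \<sigma>2" "\<And>\<sigma> u. 0 < \<sigma> \<Longrightarrow> \<sigma> < \<sigma>2 \<Longrightarrow> u \<in> U \<Longrightarrow> \<tau> *\<^sub>R a + \<sigma> *\<^sub>R (z + u) \<in> T"
    using tile_near_first_ray_tile[OF a(1) \<tau>(1,3) kK(2), of "c a" U] a(2) U Ub Uz unfolding z2 by auto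
  define \<sigma> where "\<sigma> = min \<sigma>1 \<sigma>2 / 2"
  have \<sigma>: "0 < \<sigma>" "\<sigma> < \<sigma>1" "\<sigma> < \<sigma>2" using \<sigma>1(1) \<sigma>2(1) by (auto simp: \<sigma>_def)
  define W where "W = (+) (\<tau> *\<^sub>R a + \<tau>' *\<^sub>R d + \<sigma> *\<^sub>R z) ` ((*\<^sub>R) \<sigma> ` U)"
  have "open W" unfolding W_def U_def using \<sigma> \<epsilon> by (intro open_translation open_scaling) auto
  have Wmem: "\<exists>u\<in>U. x = \<tau> *\<^sub>R a + (\<tau>' *\<^sub>R d + \<sigma> *\<^sub>R (z + u)) \<and> x = \<tau>' *\<^sub>R d + (\<tau> *\<^sub>R a + \<sigma> *\<^sub>R (z + u))" if "x \<in> W" for x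
    using that by (auto simp: W_def algebra_simps)
  have "W \<subseteq> (+) (\<tau> *\<^sub>R a) ` T" using Wmem \<sigma>1(2)[OF \<sigma>(1,2)] by blast
  moreover have "W \<subseteq> (+) (\<tau>' *\<^sub>R d) ` T" using Wmem \<sigma>2(2)[OF \<sigma>(1,3)] by blast
  ultimately have "W \<subseteq> interior ((+) (\<tau> *\<^sub>R a) ` T) \<inter> interior ((+) (\<tau>' *\<^sub>R d) ` T)"
    using \<open>open W\<close> by (simp add: interior_maximal)
  moreover have "W \<noteq> {}" using w0(1) by (auto simp: W_def U_def)
  moreover have "\<tau> *\<^sub>R a \<noteq> \<tau>' *\<^sub>R d"
  proof
    assume "\<tau> *\<^sub>R a = \<tau>' *\<^sub>R d"
    then have "(1 / \<tau>) *\<^sub>R (\<tau> *\<^sub>R a) = (\<tau>' / \<tau>) *\<^sub>R d" by simp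
    then have "a = (\<tau>' / \<tau>) *\<^sub>R d" using \<tau>(1) by simp
    moreover have "d \<in> E - {a}" using d a by auto
    then have "d \<in> convex_cone hull (E - {a})" by (rule hull_inc)
    ultimately show False using irredundant[OF a(1)] \<tau>(1) \<tau>'(1) by (auto intro: convex_cone_hull_mul)
  qed
  ultimately show False using disjoint_interiors[OF \<tau>(2) \<tau>'(2)] by blast
qed

end

section \<open>Coordinates and cubes\<close>

lemma ex_irredundant_generators:
  assumes "finite E"
  obtains F where "F \<subseteq> E" "convex_cone hull F = convex_cone hull E"
    "\<And>e. e \<in> F \<Longrightarrow> e \<notin> convex_cone hull (F - {e})"
proof -
  let ?gen = "\<lambda>F. F \<subseteq> E \<and> convex_cone hull F = convex_cone hull E"
  have "?gen E" by simp
  then obtain F where F: "?gen F" and least: "\<And>G. ?gen G \<Longrightarrow> card F \<le> card G"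
    using ex_has_least_nat[of ?gen E card] by blast
  have "e \<notin> convex_cone hull (F - {e})" if e: "e \<in> F" for e
  proof
    assume "e \<in> convex_cone hull (F - {e})"
    then have "convex_cone hull (insert e (F - {e})) = convex_cone hull (F - {e})" by (rule hull_redundant)
    then have "?gen (F - {e})" using F e by (auto simp: insert_absorb)
    from least[OF this] show False
      using card_Diff1_less[of F e] finite_subset[of F E] F assms e by simp
  qed
  then show ?thesis using F that by blast
qed

text \<open>
Independent generators of a cone with interior points are as many as the dimension, so they can be
mapped to the standard basis.
\<close>

lemma coordinates_of_independent_generators:
  fixes E :: "(real^'n) set"
  assumes ind: "independent E" and int: "interior (convex_cone hull E) \<noteq> {}"
  obtains P :: "real^'n^'n" where "invertible P" "(*v) P ` (convex_cone hull E) = nonneg_orthant"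
proof -
  have fin: "finite E" and le: "card E \<le> CARD('n)" using independent_bound[OF ind] by auto
  have "card E = CARD('n)"
  proof (rule ccontr)
    assume "card E \<noteq> CARD('n)"
    then have "dim (span E) < DIM(real^'n)" using le dim_le_card'[OF fin] by simp
    then have "negligible (span E)" by (rule negligible_lowdim)
    moreover have "convex_cone hull E \<subseteq> span E"
      by (rule hull_minimal) (auto intro: span_base convex_cone_span)
    ultimately show False
      using int open_not_negligible[of "interior (convex_cone hull E)"] interior_subset negligible_subset
      by (metis open_interior)
  qed
  then obtain \<sigma> where \<sigma>: "bij_betw \<sigma> (UNIV :: 'n set) E"
    using fin finite_same_card_bij[of "UNIV :: 'n set" E] by auto
  then have inj: "inj \<sigma>" and E: "E = range \<sigma>" by (auto simp: bij_betw_def)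
  define Q :: "real^'n^'n" where "Q = (\<chi> i j. \<sigma> j $ i)"
  have Q: "Q *v x = (\<Sum>j\<in>UNIV. x $ j *\<^sub>R \<sigma> j)" for x
    by (simp add: Q_def matrix_vector_mult_def vec_eq_iff mult.commute)
  have "inj ((*v) Q)"
  proof (subst linear_injective_0)
    show "linear ((*v) Q)" by simp
    show "\<forall>x. Q *v x = 0 \<longrightarrow> x = 0"
    proof (intro allI impI)
      fix x assume "Q *v x = 0"
      then have "(\<Sum>e\<in>E. (x $ inv \<sigma> e) *\<^sub>R e) = 0"
        unfolding Q E by (subst sum.reindex[OF inj]) (simp add: inj)
      then have "\<forall>e\<in>E. x $ inv \<sigma> e = 0" using ind fin by (auto simp: dependent_finite)
      then show "x = 0" using inj by (auto simp: E vec_eq_iff)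
    qed
  qed
  then have invQ: "invertible Q" using invertible_det_nz[of Q] det_nz_iff_inj[of "(*v) Q"]
    by (simp add: matrix_of_matrix_vector_mul)
  have "convex_cone hull E = (*v) Q ` nonneg_orthant"
  proof -
    have "convex_cone hull E = {\<Sum>i\<in>UNIV. l i *\<^sub>R \<sigma> i | l. \<forall>i\<in>UNIV. 0 \<le> l i}"
      unfolding E by (rule convex_cone_hull_indexed) simp
    also have "\<dots> = (*v) Q ` nonneg_orthant"
    proof safe
      fix l :: "'n \<Rightarrow> real" assume l: "\<forall>i\<in>UNIV. 0 \<le> l i"
      show "(\<Sum>i\<in>UNIV. l i *\<^sub>R \<sigma> i) \<in> (*v) Q ` nonneg_orthant"
        by (rule image_eqI[of _ _ "\<chi> i. l i"]) (use l in \<open>auto simp: Q nonneg_orthant_def\<close>)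
    next
      fix x :: "real^'n" assume "x \<in> nonneg_orthant"
      then show "\<exists>l. Q *v x = (\<Sum>i\<in>UNIV. l i *\<^sub>R \<sigma> i) \<and> (\<forall>i\<in>UNIV. 0 \<le> l i)"
        by (intro exI[of _ "\<lambda>i. x $ i"]) (auto simp: Q nonneg_orthant_def)
    qed
    finally show ?thesis .
  qed
  then have "(*v) (matrix_inv Q) ` (convex_cone hull E) = nonneg_orthant"
    by (simp add: image_image matrix_vector_mul_assoc matrix_inv_inverse[OF invQ])
  moreover have "invertible (matrix_inv Q)" using matrix_inv_inverse[OF invQ] unfolding invertible_def by blast
  ultimately show ?thesis using that by blast
qed

lemma frontier_nonneg_orthant: "frontier (nonneg_orthant :: (real^'n) set) \<subseteq> {x. \<exists>i. x $ i = 0}"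
proof
  fix x :: "real^'n" assume x: "x \<in> frontier nonneg_orthant"
  have "closed (nonneg_orthant :: (real^'n) set)" unfolding nonneg_orthant_def
    by (intro closed_Collect_all closed_Collect_le continuous_intros)
  then have xO: "x \<in> nonneg_orthant" "x \<notin> interior nonneg_orthant" using x by (auto simp: frontier_def)
  show "x \<in> {x. \<exists>i. x $ i = 0}"
  proof (rule ccontr)
    assume "x \<notin> {x. \<exists>i. x $ i = 0}"
    then have "x \<in> (\<Inter>i. {x. 0 < x $ i})" using xO(1) by (auto simp: nonneg_orthant_def less_le)
    moreover have "open (\<Inter>i. {x::real^'n. 0 < x $ i})"
      by (intro open_INT ballI open_Collect_less continuous_intros) auto
    moreover have "(\<Inter>i. {x::real^'n. 0 < x $ i}) \<subseteq> nonneg_orthant"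
      by (auto simp: nonneg_orthant_def less_imp_le)
    ultimately show False using xO(2) interior_maximal by blast
  qed
qed

text \<open>
If distinct points of \<open>F\<close> are at least \<open>2 \<epsilon>\<close> apart, every point off \<open>F\<close> lies in an interval of length
\<open>\<epsilon>\<close> whose interior misses \<open>F\<close>: an interval attached to a point of \<open>F\<close> closer than \<open>\<epsilon>\<close>, or, if there
is none, the cell of the grid \<open>\<epsilon> \<int>\<close>. Finitely many left endpoints suffice for a bounded range.
\<close>

lemma gap_endpoint:
  fixes \<epsilon> x M :: real
  assumes \<epsilon>: "0 < \<epsilon>" and F: "finite F" and sep: "\<And>c c'. c \<in> F \<Longrightarrow> c' \<in> F \<Longrightarrow> \<bar>c - c'\<bar> < 2 * \<epsilon> \<Longrightarrow> c = c'"
    and x: "x \<notin> F" "\<bar>x\<bar> \<le> M"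
  shows "\<exists>v \<in> F \<union> (\<lambda>c. c - \<epsilon>) ` F \<union> (\<lambda>n. \<epsilon> * real_of_int n) ` {-\<lceil>M / \<epsilon>\<rceil> - 1..\<lceil>M / \<epsilon>\<rceil>}.
     v \<le> x \<and> x \<le> v + \<epsilon> \<and> (\<forall>c\<in>F. \<not> (v < c \<and> c < v + \<epsilon>))"
proof -
  consider c where "c \<in> F" "c < x" "x < c + \<epsilon>" | c where "c \<in> F" "x < c" "c < x + \<epsilon>"
    | "\<forall>c\<in>F. \<epsilon> \<le> \<bar>c - x\<bar>" using x(1) by (metis abs_diff_less_iff diff_less_eq less_linear not_le add.commute)
  then show ?thesis
  proof cases
    case (1 c)
    have "\<not> (c < c' \<and> c' < c + \<epsilon>)" if "c' \<in> F" for c'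
      using sep[OF 1(1) that] \<epsilon> by auto
    then show ?thesis using 1 by (intro bexI[of _ c]) auto
  next
    case (2 c)
    have "\<not> (c - \<epsilon> < c' \<and> c' < c - \<epsilon> + \<epsilon>)" if "c' \<in> F" for c'
      using sep[OF 2(1) that] \<epsilon> by auto
    then show ?thesis using 2 by (intro bexI[of _ "c - \<epsilon>"]) auto
  next
    case 3
    let ?n = "\<lfloor>x / \<epsilon>\<rfloor>"
    have n: "\<epsilon> * real_of_int ?n \<le> x" "x < \<epsilon> * real_of_int ?n + \<epsilon>"
      using \<epsilon> mult_left_mono[OF of_int_floor_le[of "x / \<epsilon>"], of \<epsilon>] floor_correct[of "x / \<epsilon>"]
      by (simp_all add: field_simps)
    have "?n \<in> {-\<lceil>M / \<epsilon>\<rceil> - 1..\<lceil>M / \<epsilon>\<rceil>}"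
    proof -
      have "x / \<epsilon> \<le> M / \<epsilon>" "- (M / \<epsilon>) \<le> x / \<epsilon>" using x(2) \<epsilon> by (auto simp: divide_le_cancel field_simps)
      then show ?thesis using floor_correct[of "x/\<epsilon>"] ceiling_correct[of "M/\<epsilon>"] by simp linarith
    qed
    moreover have "\<not> (\<epsilon> * real_of_int ?n < c \<and> c < \<epsilon> * real_of_int ?n + \<epsilon>)" if "c \<in> F" for c
      using 3 that n by fastforce
    ultimately show ?thesis using n by (intro bexI[of _ "\<epsilon> * real_of_int ?n"]) auto
  qed
qed

text \<open>
Around a generic point of \<open>S\<close>, \<open>gap_endpoint\<close> in each coordinate gives a cube of side \<open>\<epsilon>\<close> whose
interior meets none of the hyperplanes that contain the frontier, so the cube lies in \<open>S\<close>. Only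
finitely many cubes arise, hence their union is closed and contains the closure of the generic
points. The cubes may overlap, so the spacing of the hyperplanes need not be commensurable.
\<close>

lemma finite_union_of_cubes:
  fixes S :: "(real^'n) set"
  assumes S: "compact S" "closure (interior S) = S"
    and F: "finite F" "frontier S \<subseteq> {x. \<exists>i. x $ i \<in> F}"
  obtains \<epsilon> V where "0 < \<epsilon>" "finite V" "S = (\<Union>v\<in>V. cbox v (v + (\<chi> i. \<epsilon>)))"
proof -
  obtain e where e: "0 < e" "\<And>c c'. c \<in> F \<Longrightarrow> c' \<in> F \<Longrightarrow> dist c c' < e \<Longrightarrow> c = c'"
    using F(1) uniform_discrete_finite_iff[of F] unfolding uniform_discrete_def by blast
  define \<epsilon> where "\<epsilon> = e / 2"
  have \<epsilon>: "0 < \<epsilon>" "\<And>c c'. c \<in> F \<Longrightarrow> c' \<in> F \<Longrightarrow> \<bar>c - c'\<bar> < 2 * \<epsilon> \<Longrightarrow> c = c'"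
    using e by (auto simp: \<epsilon>_def dist_real_def)
  obtain M where M: "\<And>x. x \<in> S \<Longrightarrow> norm x \<le> M"
    using compact_imp_bounded[OF S(1)] by (auto simp: bounded_iff)
  define G where "G = F \<union> (\<lambda>c. c - \<epsilon>) ` F \<union> (\<lambda>n. \<epsilon> * real_of_int n) ` {-\<lceil>M / \<epsilon>\<rceil> - 1..\<lceil>M / \<epsilon>\<rceil>}"
  let ?d = "(\<chi> i. \<epsilon>) :: real^'n"
  define V where "V = {v::real^'n. (\<forall>i. v $ i \<in> G) \<and> cbox v (v + ?d) \<subseteq> S}"
  have "finite {v::real^'n. \<forall>i. v $ i \<in> G}"
  proof (rule finite_subset)
    show "{v::real^'n. \<forall>i. v $ i \<in> G} \<subseteq> (\<lambda>f. \<chi> i. f i) ` (UNIV \<rightarrow>\<^sub>E G)"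
    proof
      fix v :: "real^'n" assume "v \<in> {v. \<forall>i. v $ i \<in> G}"
      then show "v \<in> (\<lambda>f. \<chi> i. f i) ` (UNIV \<rightarrow>\<^sub>E G)"
        by (intro image_eqI[of _ _ "\<lambda>i. v $ i"]) auto
    qed
    show "finite ((\<lambda>f. \<chi> i. f i) ` (UNIV \<rightarrow>\<^sub>E G) :: (real^'n) set)"
      using F(1) by (intro finite_imageI finite_PiE) (auto simp: G_def)
  qed
  then have fV: "finite V" by (rule finite_subset[rotated]) (auto simp: V_def)
  have generic: "x \<in> (\<Union>v\<in>V. cbox v (v + ?d))" if x: "x \<in> S" "\<forall>i. x $ i \<notin> F" for x
  proof -
    have "\<exists>v\<in>G. v \<le> x $ i \<and> x $ i \<le> v + \<epsilon> \<and> (\<forall>c\<in>F. \<not> (v < c \<and> c < v + \<epsilon>))" for i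
      unfolding G_def
      by (rule gap_endpoint[OF \<epsilon>(1) F(1) \<epsilon>(2)])
        (use x M[OF x(1)] component_le_norm_cart[of x i] in auto)
    then obtain w where w: "\<And>i. w i \<in> G \<and> w i \<le> x $ i \<and> x $ i \<le> w i + \<epsilon> \<and> (\<forall>c\<in>F. \<not> (w i < c \<and> c < w i + \<epsilon>))"
      by metis
    define v :: "real^'n" where "v = (\<chi> i. w i)"
    have ne: "box v (v + ?d) \<noteq> {}" using \<epsilon>(1) by (simp add: interval_ne_empty_cart)
    have xv: "x \<in> cbox v (v + ?d)" using w by (simp add: mem_box_cart v_def)
    have cl: "closure (box v (v + ?d)) = cbox v (v + ?d)" using ne by (rule closure_box)
    have "connected (insert x (box v (v + ?d)))"
    proof (rule connected_intermediate_closure)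
      show "connected (box v (v + ?d))" by (intro convex_connected convex_box)
    qed (use cl xv closure_subset in auto)
    moreover have "insert x (box v (v + ?d)) \<inter> frontier S = {}"
      using F(2) w x(2) by (fastforce simp: mem_box_cart v_def)
    ultimately have "insert x (box v (v + ?d)) \<subseteq> S"
      using connected_Int_frontier[of "insert x (box v (v + ?d))" S] x(1) by blast
    then have "closure (box v (v + ?d)) \<subseteq> S"
      by (intro closure_minimal compact_imp_closed[OF S(1)]) auto
    then have "v \<in> V" using w unfolding cl by (simp add: V_def v_def)
    then show ?thesis using xv by blast
  qed
  have "S \<subseteq> (\<Union>v\<in>V. cbox v (v + ?d))"
  proof
    fix x assume "x \<in> S"
    have clU: "closed (\<Union>v\<in>V. cbox v (v + ?d))" using fV by (intro closed_UN) auto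
    have "x \<in> closure (\<Union>v\<in>V. cbox v (v + ?d))"
      unfolding closure_approachable
    proof (intro allI impI)
      fix r :: real assume r: "0 < r"
      have "open (interior S \<inter> ball x r)" by auto
      moreover have "interior S \<inter> ball x r \<noteq> {}"
        using \<open>x \<in> S\<close> S(2) r unfolding closure_approachable set_eq_iff
        by (metis (no_types, lifting) Int_iff closure_approachable dist_commute empty_iff mem_ball)
      moreover have "finite ((\<lambda>(i, c). (axis i 1 :: real^'n, c)) ` (UNIV \<times> F))" using F(1) by simp
      moreover have "\<forall>(a, c)\<in>(\<lambda>(i, c). (axis i 1 :: real^'n, c)) ` (UNIV \<times> F). a \<noteq> 0"
        by (auto simp: axis_eq_0_iff)
      ultimately obtain z where z: "z \<in> interior S \<inter> ball x r"
        "\<forall>(a, c)\<in>(\<lambda>(i, c). (axis i 1 :: real^'n, c)) ` (UNIV \<times> F). a \<bullet> z \<noteq> c"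
        by (rule finite_hyperplanes_avoided_by_open)
      then have "\<forall>i. z $ i \<notin> F" by (auto simp: inner_axis')
      moreover have "z \<in> S" using z(1) interior_subset by blast
      ultimately have "z \<in> (\<Union>v\<in>V. cbox v (v + ?d))" using generic by blast
      moreover have "dist z x < r" using z(1) by (simp add: dist_commute)
      ultimately show "\<exists>y\<in>\<Union>v\<in>V. cbox v (v + ?d). dist y x < r" by (rule bexI[rotated])
    qed
    then show "x \<in> (\<Union>v\<in>V. cbox v (v + ?d))" using clU by simp
  qed
  moreover have "(\<Union>v\<in>V. cbox v (v + ?d)) \<subseteq> S" by (auto simp: V_def)
  ultimately show ?thesis using that[OF \<epsilon>(1) fV] by blast
qed

lemma frontier_injective_linear_image:
  fixes f :: "'a::euclidean_space \<Rightarrow> 'a"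
  assumes "linear f" "inj f"
  shows "frontier (f ` S) = f ` frontier S"
  using assms
  by (simp add: frontier_def closure_injective_linear_image interior_injective_linear_image image_set_diff)

theorem theorem1p2:
  fixes A :: "real^'n^'n" and D T :: "(real^'n) set"
  assumes "self_affine_tile A D T"
    and "has_polyhedral_corner T"
  shows "(\<exists>\<phi>. affine_transformation \<phi> \<and> orthant_tile (\<phi> ` T)) \<and>
         (\<exists>\<psi> F. affine_transformation \<psi> \<and> finite F \<and>
            \<psi> ` T = (\<Union>v\<in>F. (\<lambda>x. x + v) ` unit_cube))"
proof -
  note tile = assms(1)
  have cT: "compact T" and intT: "interior T \<noteq> {}"
    using tile by (auto simp: self_affine_tile_def self_affine_set_def)
  note reg = self_affine_tile_regular_closed[OF tile]
  obtain y b E0 j R where 0: "y \<in> T" "finite E0" "\<And>e. e \<in> E0 \<Longrightarrow> 0 < b \<bullet> e"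
    "germ_at T y (convex_cone hull E0)" "\<And>x. x \<in> T \<Longrightarrow> x - y \<in> convex_cone hull E0"
    "j \<ge> 1" "((*v) A ^^ j) ` (convex_cone hull E0) = convex_cone hull E0"
    "finite R" "frontier T \<subseteq> (\<Union>p\<in>R. (+) p ` frontier (convex_cone hull E0))"
    by (rule invariant_cone_at_apex[OF assms]) (rule that)
  obtain E where E: "E \<subseteq> E0" "convex_cone hull E = convex_cone hull E0"
    "\<And>e. e \<in> E \<Longrightarrow> e \<notin> convex_cone hull (E - {e})"
    using ex_irredundant_generators[OF 0(2)] by blast
  define K where "K = convex_cone hull E"
  note KE = K_def[unfolded E(2), symmetric]
  have fE: "finite E" using E(1) 0(2) by (rule finite_subset)
  have bE: "\<And>e. e \<in> E \<Longrightarrow> 0 < b \<bullet> e" using E(1) 0(3) by blast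
  obtain J where J: "(\<Union>t\<in>J. (+) (t - y) ` T) = K"
    "\<And>s t. s \<in> J \<Longrightarrow> t \<in> J \<Longrightarrow> s \<noteq> t \<Longrightarrow> negligible ((+) (s - y) ` T \<inter> (+) (t - y) ` T)"
    using cone_tiling_of_invariant_cone[OF tile K_def fE bE 0(1) 0(4,5,6,7)[unfolded KE]] by blast
  \<comment> \<open>The tile moved so that its apex is the origin.\<close>
  define T' where "T' = (+) (- y) ` T"
  have shift: "(+) (t - y) ` T = (+) t ` T'" for t
    unfolding T'_def image_image by (auto intro!: image_cong)
  have intT': "interior T' \<noteq> {}" unfolding T'_def interior_translation using intT by simp
  have TK: "T' \<subseteq> K" using 0(5) unfolding KE T'_def by auto
  have J': "(\<Union>t\<in>J. (+) t ` T') = K"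
    "\<And>s t. s \<in> J \<Longrightarrow> t \<in> J \<Longrightarrow> s \<noteq> t \<Longrightarrow> negligible ((+) s ` T' \<inter> (+) t ` T')"
    using J unfolding shift by auto
  interpret cone_tiling E T' J b K
  proof
    show "compact T'" unfolding T'_def using cT by (rule compact_translation)
    show "0 \<in> T'" unfolding T'_def using 0(1) by force
    show "interior ((+) s ` T') \<inter> interior ((+) t ` T') = {}" if "s \<in> J" "t \<in> J" "s \<noteq> t" for s t
      using J'(2)[OF that] by (rule interior_Int_empty_if_negligible)
  qed (use fE bE E(3) K_def intT' TK J' in auto)
  have intK: "interior K \<noteq> {}" using intT' TK interior_mono by blast
  have ind: "independent E" by (rule independent_generators[OF intK])
  obtain P :: "real^'n^'n" where P: "invertible P" "(*v) P ` K = nonneg_orthant"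
    using coordinates_of_independent_generators[OF ind] intK unfolding K_def by blast
  have injP: "inj ((*v) P)" using P(1) by (simp add: inj_matrix_vector_mult)
  have linP: "linear ((*v) P)" by simp
  define \<phi> where "\<phi> = (\<lambda>x. P *v x + (- (P *v y)))"
  define S where "S = \<phi> ` T"
  have S: "S = (*v) P ` T'"
    by (simp add: S_def \<phi>_def T'_def image_image matrix_vector_mult_diff_distrib)
  have aff: "affine_transformation \<phi>" using P(1) unfolding affine_transformation_def \<phi>_def by blast
  have cS: "compact S" unfolding S
    by (rule compact_continuous_image[OF linear_continuous_on compact_T]) (simp add: linear_conv_bounded_linear[symmetric])
  have transl: "(\<lambda>s. s + P *v t) ` S = (*v) P ` ((+) t ` T')" for t
    by (simp add: S image_image matrix_vector_right_distrib add.commute)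
  have null: "negligible ((\<lambda>s. s + P *v t1) ` S \<inter> (\<lambda>s. s + P *v t2) ` S)"
    if "t1 \<in> J" "t2 \<in> J" "t1 \<noteq> t2" for t1 t2
  proof -
    have "(\<lambda>s. s + P *v t1) ` S \<inter> (\<lambda>s. s + P *v t2) ` S = (*v) P ` ((+) t1 ` T' \<inter> (+) t2 ` T')"
      unfolding transl using injP by (simp add: image_Int)
    moreover have "negligible \<dots>"
      using lmeasurable_linear_image[OF linP negligible_imp_measurable[OF J'(2)[OF that]]]
        negligible_imp_measure0[OF J'(2)[OF that]] by (simp add: negligible_iff_measure)
    ultimately show ?thesis by simp
  qed
  have "orthant_tile S"
    unfolding orthant_tile_def
  proof (intro conjI exI[of _ "(*v) P ` J"] cS)
    have "uniform_discrete ((*v) P ` J)"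
    proof (rule uniform_discrete_translates)
      show "interior S \<noteq> {}" using intT' unfolding S by (simp add: interior_injective_linear_image[OF linP injP])
      show "interior ((+) s ` S) \<inter> interior ((+) t ` S) = {}"
        if "s \<in> (*v) P ` J" "t \<in> (*v) P ` J" "s \<noteq> t" for s t
        using that null by (intro interior_Int_empty_if_negligible) (auto simp: add.commute)
    qed
    then show "discrete ((*v) P ` J)" by (rule uniform_discrete_imp_discrete)
    have "{s + t |s t. s \<in> S \<and> t \<in> (*v) P ` J} = (\<Union>t\<in>J. (\<lambda>s. s + P *v t) ` S)" by auto
    also have "\<dots> = nonneg_orthant" unfolding transl P(2)[symmetric] J'(1)[symmetric] by auto
    finally show "{s + t |s t. s \<in> S \<and> t \<in> (*v) P ` J} = nonneg_orthant" .
    show "\<forall>t1\<in>(*v) P ` J. \<forall>t2\<in>(*v) P ` J. t1 \<noteq> t2 \<longrightarrow>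
        (\<lambda>s. s + t1) ` S \<inter> (\<lambda>s. s + t2) ` S \<in> null_sets lebesgue"
      using null by (auto simp: negligible_iff_null_sets)
  qed
  moreover
  obtain \<epsilon> V where V: "0 < \<epsilon>" "finite V" "S = (\<Union>v\<in>V. cbox v (v + (\<chi> i. \<epsilon>)))"
  proof (rule finite_union_of_cubes[OF cS])
    have "closure (interior T') = T'" unfolding T'_def interior_translation closure_translation reg ..
    then show "closure (interior S) = S"
      unfolding S by (simp add: interior_injective_linear_image[OF linP injP] closure_injective_linear_image[OF linP injP, symmetric])
    \<comment> \<open>The frontier consists of parts of translates of coordinate hyperplanes; \<open>?F\<close> collects the coordinates
      of the translation vectors.\<close>
    let ?F = "(\<lambda>(p, i). (P *v (p - y)) $ i) ` (R \<times> UNIV)"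
    show "finite ?F" using 0(8) by simp
    show "frontier S \<subseteq> {x. \<exists>i. x $ i \<in> ?F}"
    proof
      fix x assume "x \<in> frontier S"
      then obtain z where z: "z \<in> frontier T'" "x = P *v z"
        unfolding S frontier_injective_linear_image[OF linP injP] by blast
      obtain u where u: "u \<in> frontier T" "z = - y + u"
        using z(1) unfolding T'_def frontier_translation by blast
      obtain p k where p: "p \<in> R" "k \<in> frontier K" "u = p + k" using u(1) 0(9) unfolding KE by blast
      have "P *v k \<in> frontier nonneg_orthant"
        unfolding P(2)[symmetric] frontier_injective_linear_image[OF linP injP] using p(2) by (rule imageI)
      then obtain i where "(P *v k) $ i = 0" using frontier_nonneg_orthant by blast
      moreover have "x = P *v (p - y) + P *v k"
        by (simp add: z(2) u(2) p(3) flip: matrix_vector_right_distrib) (simp add: algebra_simps)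
      ultimately have "x $ i = (P *v (p - y)) $ i" by simp
      then show "x \<in> {x. \<exists>i. x $ i \<in> ?F}" using p(1) by (auto intro!: exI[of _ i] image_eqI[of _ _ "(p, i)"])
    qed
  qed
  define \<psi> where "\<psi> = (\<lambda>x. ((1 / \<epsilon>) *\<^sub>R P) *v x + (1 / \<epsilon>) *\<^sub>R (- (P *v y)))"
  have \<psi>: "\<psi> x = (1 / \<epsilon>) *\<^sub>R \<phi> x" for x
    by (simp add: \<psi>_def \<phi>_def scaleR_matrix_vector_assoc[symmetric] scaleR_diff_right)
  have "affine_transformation \<psi>"
  proof -
    have "invertible ((1 / \<epsilon>) *\<^sub>R P)" using P(1) V(1) by (simp add: scalar_invertible)
    then show ?thesis unfolding affine_transformation_def \<psi>_def by blast
  qed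
  moreover have "\<psi> ` T = (\<Union>v\<in>(*\<^sub>R) (1 / \<epsilon>) ` V. (\<lambda>x. x + v) ` unit_cube)"
  proof -
    have cube: "(*\<^sub>R) (1 / \<epsilon>) ` cbox v (v + (\<chi> i. \<epsilon>)) = (\<lambda>x. x + (1 / \<epsilon>) *\<^sub>R v) ` unit_cube" for v :: "real^'n"
    proof (intro equalityI subsetI)
      fix x assume "x \<in> (*\<^sub>R) (1 / \<epsilon>) ` cbox v (v + (\<chi> i. \<epsilon>))"
      then obtain z where z: "z \<in> cbox v (v + (\<chi> i. \<epsilon>))" "x = (1 / \<epsilon>) *\<^sub>R z" by blast
      show "x \<in> (\<lambda>x. x + (1 / \<epsilon>) *\<^sub>R v) ` unit_cube"
        by (rule image_eqI[of _ _ "(1 / \<epsilon>) *\<^sub>R (z - v)"])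
          (use z V(1) in \<open>auto simp: mem_box_cart unit_cube_def algebra_simps field_simps\<close>)
    next
      fix x assume "x \<in> (\<lambda>x. x + (1 / \<epsilon>) *\<^sub>R v) ` unit_cube"
      then obtain c where c: "c \<in> unit_cube" "x = c + (1 / \<epsilon>) *\<^sub>R v" by blast
      show "x \<in> (*\<^sub>R) (1 / \<epsilon>) ` cbox v (v + (\<chi> i. \<epsilon>))"
        by (rule image_eqI[of _ _ "\<epsilon> *\<^sub>R c + v"])
          (use c V(1) in \<open>auto simp: mem_box_cart unit_cube_def algebra_simps mult_left_le\<close>)
    qed
    have "\<psi> ` T = (*\<^sub>R) (1 / \<epsilon>) ` S" by (simp add: S_def \<psi> image_image)
    then show ?thesis by (simp only: V(3) image_UN cube) auto
  qed
  ultimately show ?thesis using aff V(2) unfolding S_def by blast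
qed

end
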